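(* Let $n\ge 2$ and let $p\in\mathbb C[x_1,x_2,\ldots,x_n]$ be a polynomial which is linear in each variable separately and whose zero set is smooth and reduced. Let $$X=\{(u,v,x)\in\mathbb C^{n+2}: uv-p(x)=0\}$$ with the action of $T=\mathbb C^*$ given by $t\cdot(u,v,x)=(tu,t^{-1}v,x)$. Then $X$ is $T$-elliptic.
   Context: Linear in each variable separately means of degree at most $1$ in each variable $x_i$. The zero set of $p$ is smooth and reduced if whenever $p(x)=0$, at least one of the partial derivatives $\partial p/\partial x_i(x)$ does not vanish. A spray on a complex manifold $X$ is a holomorphic map $s:E\to X$ defined on the total space of a holomorphic vector bundle $E$ on $X$ such that $s(0_x)=x$ for all $x\in X$; it is dominating if $s|_{E_x}:E_x\to X$ is a submersion at $0_x$ for all $x\in X$. Given a holomorphic action of a complex Lie group $T$ on $X$, it is a $T$-spray if the action on $X$ lifts to a holomorphic action on $E$ by vector bundle isomorphisms such that both $s$ and the projection $E\to X$ are $T$-equivariant. $X$ is $T$-elliptic if it carries a dominating $T$-spray. *)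

theory Defs
  imports "HOL-Analysis.Analysis" "HOL-Analysis.Finite_Function_Topology" "HOL-Algebra.Group"
begin

subsection \<open>The spaces \<open>\<complex>\<^sup>d\<close> and holomorphic maps between them\<close>

text \<open>
  The dimensions of manifolds and the ranks of bundles are quantified inside the statement, so
  \<open>\<complex>\<^sup>d\<close> is realised, for every natural number \<open>d\<close>, as the subspace \<open>Cn d\<close> of the normed space of
  finitely supported sequences.
\<close>

type_synonym cvec = "nat \<Rightarrow>\<^sub>0 complex"

definition Cn :: "nat \<Rightarrow> cvec set" where
  "Cn d = {x. Poly_Mapping.keys x \<subseteq> {..<d}}"

definition cscale :: "complex \<Rightarrow> cvec \<Rightarrow> cvec" where
  "cscale c x = Poly_Mapping.map ((*) c) x"

text \<open>The identification \<open>\<complex>\<^sup>d \<times> \<complex>\<^sup>e \<cong> \<complex>\<^sup>d\<^sup>+\<^sup>e\<close>:\<close>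

definition cat :: "nat \<Rightarrow> cvec \<Rightarrow> cvec \<Rightarrow> cvec" where
  "cat d x y =
     x + (\<Sum>i\<in>Poly_Mapping.keys y. Poly_Mapping.single (d + i) (Poly_Mapping.lookup y i))"

text \<open>
  \<open>D\<close> is a complex-linear (Frechet) derivative at \<open>x\<close> of the map \<open>f\<close> defined on the open subset
  \<open>S\<close> of \<open>\<complex>\<^sup>d\<close>. Only the restriction of \<open>D\<close> to \<open>Cn d\<close> is determined, and only this restriction
  is ever used.
\<close>

definition has_complex_derivative ::
    "nat \<Rightarrow> cvec set \<Rightarrow> (cvec \<Rightarrow> cvec) \<Rightarrow> cvec \<Rightarrow> (cvec \<Rightarrow> cvec) \<Rightarrow> bool" where
  "has_complex_derivative d S f x D \<longleftrightarrow>
     (f has_derivative D) (at x within S) \<and>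
     (\<forall>c. \<forall>h\<in>Cn d. D (cscale c h) = cscale c (D h))"

definition cholomorphic :: "nat \<Rightarrow> cvec set \<Rightarrow> (cvec \<Rightarrow> cvec) \<Rightarrow> bool" where
  "cholomorphic d S f \<longleftrightarrow>
     openin (top_of_set (Cn d)) S \<and> (\<forall>x\<in>S. \<exists>D. has_complex_derivative d S f x D)"

subsection \<open>Complex manifolds\<close>

record 'a cmanifold =
  mtop :: "'a topology"
  mdim :: nat
  mcharts :: "('a set \<times> ('a \<Rightarrow> cvec)) set"

abbreviation points :: "'a cmanifold \<Rightarrow> 'a set" where
  "points M \<equiv> topspace (mtop M)"

definition complex_manifold :: "'a cmanifold \<Rightarrow> bool" where
  "complex_manifold M \<longleftrightarrow>
     Hausdorff_space (mtop M) \<and> second_countable (mtop M) \<and>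
     (\<Union>(U, \<phi>)\<in>mcharts M. U) = points M \<and>
     (\<forall>(U, \<phi>)\<in>mcharts M.
        openin (mtop M) U \<and> openin (top_of_set (Cn (mdim M))) (\<phi> ` U) \<and>
        homeomorphic_map (subtopology (mtop M) U) (top_of_set (\<phi> ` U)) \<phi>) \<and>
     (\<forall>(U, \<phi>)\<in>mcharts M. \<forall>(V, \<psi>)\<in>mcharts M.
        cholomorphic (mdim M) (\<phi> ` (U \<inter> V)) (\<psi> \<circ> inv_into U \<phi>))"

definition holomorphic_map :: "'a cmanifold \<Rightarrow> 'b cmanifold \<Rightarrow> ('a \<Rightarrow> 'b) \<Rightarrow> bool" where
  "holomorphic_map M N f \<longleftrightarrow>
     continuous_map (mtop M) (mtop N) f \<and>
     (\<forall>(U, \<phi>)\<in>mcharts M. \<forall>(V, \<psi>)\<in>mcharts N.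
        cholomorphic (mdim M) (\<phi> ` {x \<in> U. f x \<in> V}) (\<psi> \<circ> f \<circ> inv_into U \<phi>))"

definition biholomorphic_map :: "'a cmanifold \<Rightarrow> 'b cmanifold \<Rightarrow> ('a \<Rightarrow> 'b) \<Rightarrow> bool" where
  "biholomorphic_map M N f \<longleftrightarrow>
     holomorphic_map M N f \<and>
     (\<exists>g. holomorphic_map N M g \<and>
          (\<forall>x\<in>points M. g (f x) = x) \<and> (\<forall>y\<in>points N. f (g y) = y))"

text \<open>The differential of \<open>f\<close> at \<open>x\<close>, expressed in charts, is surjective.\<close>

definition submersion_at :: "'a cmanifold \<Rightarrow> 'b cmanifold \<Rightarrow> ('a \<Rightarrow> 'b) \<Rightarrow> 'a \<Rightarrow> bool" where
  "submersion_at M N f x \<longleftrightarrow>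
     (\<forall>(U, \<phi>)\<in>mcharts M. \<forall>(V, \<psi>)\<in>mcharts N. x \<in> U \<longrightarrow> f x \<in> V \<longrightarrow>
        (\<exists>D. has_complex_derivative (mdim M) (\<phi> ` {y \<in> U. f y \<in> V})
               (\<psi> \<circ> f \<circ> inv_into U \<phi>) (\<phi> x) D \<and>
             D ` Cn (mdim M) = Cn (mdim N)))"

definition Cn_manifold :: "nat \<Rightarrow> cvec cmanifold" where
  "Cn_manifold d = \<lparr>mtop = top_of_set (Cn d), mdim = d, mcharts = {(Cn d, id)}\<rparr>"

definition open_submanifold :: "'a cmanifold \<Rightarrow> 'a set \<Rightarrow> 'a cmanifold" where
  "open_submanifold M W =
     \<lparr>mtop = subtopology (mtop M) W, mdim = mdim M,
      mcharts = {(U \<inter> W, \<phi>) |U \<phi>. (U, \<phi>) \<in> mcharts M}\<rparr>"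

definition prod_manifold :: "'a cmanifold \<Rightarrow> 'b cmanifold \<Rightarrow> ('a \<times> 'b) cmanifold" where
  "prod_manifold M N =
     \<lparr>mtop = prod_topology (mtop M) (mtop N), mdim = mdim M + mdim N,
      mcharts = {(U \<times> V, \<lambda>(x, y). cat (mdim M) (\<phi> x) (\<psi> y)) |U \<phi> V \<psi>.
                   (U, \<phi>) \<in> mcharts M \<and> (V, \<psi>) \<in> mcharts N}\<rparr>"

text \<open>
  A function on an arbitrary subset \<open>S\<close> of \<open>\<complex>\<^sup>N\<close> is holomorphic if it extends holomorphically to an
  open subset of \<open>\<complex>\<^sup>N\<close> near every point of \<open>S\<close>.
\<close>

definition cholomorphic_on_subset :: "nat \<Rightarrow> cvec set \<Rightarrow> (cvec \<Rightarrow> cvec) \<Rightarrow> bool" where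
  "cholomorphic_on_subset N S f \<longleftrightarrow>
     (\<forall>x\<in>S. \<exists>W F. x \<in> W \<and> cholomorphic N W F \<and> (\<forall>y\<in>W \<inter> S. f y = F y))"

text \<open>
  The structure that \<open>\<complex>\<^sup>N\<close> induces on a subset \<open>X\<close>; its charts are all biholomorphic maps from a
  relatively open subset of \<open>X\<close> onto an open subset of \<open>\<complex>\<^sup>d\<close>. It is a complex manifold precisely if
  \<open>X\<close> is a \<open>d\<close>-dimensional complex submanifold of \<open>\<complex>\<^sup>N\<close>, and this is never assumed: it is part of
  the definition of ellipticity below.
\<close>

definition induced_manifold :: "nat \<Rightarrow> nat \<Rightarrow> cvec set \<Rightarrow> cvec cmanifold" where
  "induced_manifold N d X =
     \<lparr>mtop = top_of_set X, mdim = d,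
      mcharts = {(U, \<phi>). openin (top_of_set X) U \<and> inj_on \<phi> U \<and>
                   openin (top_of_set (Cn d)) (\<phi> ` U) \<and>
                   cholomorphic_on_subset N U \<phi> \<and>
                   cholomorphic d (\<phi> ` U) (inv_into U \<phi>)}\<rparr>"

subsection \<open>Holomorphic vector bundles and sprays\<close>

record ('e, 'a) vbundle =
  total :: "'e cmanifold"
  proj :: "'e \<Rightarrow> 'a"
  brank :: nat
  badd :: "'e \<Rightarrow> 'e \<Rightarrow> 'e"
  bscale :: "complex \<Rightarrow> 'e \<Rightarrow> 'e"
  bzero :: "'a \<Rightarrow> 'e"

definition over :: "('e, 'a) vbundle \<Rightarrow> 'a set \<Rightarrow> 'e set" where
  "over B U = {e \<in> points (total B). proj B e \<in> U}"

abbreviation fibre :: "('e, 'a) vbundle \<Rightarrow> 'a \<Rightarrow> 'e set" where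
  "fibre B x \<equiv> over B {x}"

definition local_trivialization ::
    "'a cmanifold \<Rightarrow> ('e, 'a) vbundle \<Rightarrow> 'a set \<Rightarrow> ('e \<Rightarrow> 'a \<times> cvec) \<Rightarrow> bool" where
  "local_trivialization X B U \<Phi> \<longleftrightarrow>
     openin (mtop X) U \<and>
     biholomorphic_map (open_submanifold (total B) (over B U))
       (prod_manifold (open_submanifold X U) (Cn_manifold (brank B))) \<Phi> \<and>
     (\<forall>e\<in>over B U. fst (\<Phi> e) = proj B e) \<and>
     (\<forall>x\<in>U. snd (\<Phi> (bzero B x)) = 0 \<and>
        (\<forall>e\<in>fibre B x. \<forall>f\<in>fibre B x. snd (\<Phi> (badd B e f)) = snd (\<Phi> e) + snd (\<Phi> f)) \<and>
        (\<forall>c. \<forall>e\<in>fibre B x. snd (\<Phi> (bscale B c e)) = cscale c (snd (\<Phi> e))))"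

text \<open>
  The vector space axioms for the fibres need not be listed: by the closure conditions, a local
  trivialization transports the operations on \<open>fibre B x\<close> bijectively to those of \<open>\<complex>\<^sup>r\<close>.
\<close>

definition holomorphic_vector_bundle :: "'a cmanifold \<Rightarrow> ('e, 'a) vbundle \<Rightarrow> bool" where
  "holomorphic_vector_bundle X B \<longleftrightarrow>
     complex_manifold X \<and> complex_manifold (total B) \<and> holomorphic_map (total B) X (proj B) \<and>
     (\<forall>x\<in>points X. bzero B x \<in> fibre B x \<and>
        (\<forall>e\<in>fibre B x. \<forall>f\<in>fibre B x. badd B e f \<in> fibre B x) \<and>
        (\<forall>c. \<forall>e\<in>fibre B x. bscale B c e \<in> fibre B x)) \<and>
     (\<forall>x\<in>points X. \<exists>U \<Phi>. x \<in> U \<and> local_trivialization X B U \<Phi>)"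

text \<open>The fibre as a complex manifold, with the linear isomorphisms onto \<open>\<complex>\<^sup>r\<close> as its charts:\<close>

definition fibre_manifold :: "('e, 'a) vbundle \<Rightarrow> 'a \<Rightarrow> 'e cmanifold" where
  "fibre_manifold B x =
     \<lparr>mtop = subtopology (mtop (total B)) (fibre B x), mdim = brank B,
      mcharts = {(fibre B x, \<phi>) |\<phi>. bij_betw \<phi> (fibre B x) (Cn (brank B)) \<and>
        (\<forall>e\<in>fibre B x. \<forall>f\<in>fibre B x. \<phi> (badd B e f) = \<phi> e + \<phi> f) \<and>
        (\<forall>c. \<forall>e\<in>fibre B x. \<phi> (bscale B c e) = cscale c (\<phi> e))}\<rparr>"

definition spray :: "'a cmanifold \<Rightarrow> ('e, 'a) vbundle \<Rightarrow> ('e \<Rightarrow> 'a) \<Rightarrow> bool" where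
  "spray X B s \<longleftrightarrow>
     holomorphic_vector_bundle X B \<and> holomorphic_map (total B) X s \<and>
     (\<forall>x\<in>points X. s (bzero B x) = x)"

definition dominating :: "'a cmanifold \<Rightarrow> ('e, 'a) vbundle \<Rightarrow> ('e \<Rightarrow> 'a) \<Rightarrow> bool" where
  "dominating X B s \<longleftrightarrow>
     (\<forall>x\<in>points X. submersion_at (fibre_manifold B x) X s (bzero B x))"

subsection \<open>Group actions and ellipticity\<close>

text \<open>A complex Lie group is a group \<open>G\<close> together with a complex manifold \<open>T\<close> on its carrier.\<close>

definition complex_lie_group :: "('g, 'm) monoid_scheme \<Rightarrow> 'g cmanifold \<Rightarrow> bool" where
  "complex_lie_group G T \<longleftrightarrow>
     group G \<and> complex_manifold T \<and> points T = carrier G \<and>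
     holomorphic_map (prod_manifold T T) T (\<lambda>(g, h). g \<otimes>\<^bsub>G\<^esub> h) \<and>
     holomorphic_map T T (\<lambda>g. inv\<^bsub>G\<^esub> g)"

definition holomorphic_action ::
    "('g, 'm) monoid_scheme \<Rightarrow> 'g cmanifold \<Rightarrow> 'a cmanifold \<Rightarrow> ('g \<Rightarrow> 'a \<Rightarrow> 'a) \<Rightarrow> bool" where
  "holomorphic_action G T X a \<longleftrightarrow>
     holomorphic_map (prod_manifold T X) X (\<lambda>(g, x). a g x) \<and>
     (\<forall>x\<in>points X. a \<one>\<^bsub>G\<^esub> x = x) \<and>
     (\<forall>g\<in>carrier G. \<forall>h\<in>carrier G. \<forall>x\<in>points X. a (g \<otimes>\<^bsub>G\<^esub> h) x = a g (a h x))"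

text \<open>
  \<open>b\<close> lifts the action \<open>a\<close> to the bundle \<open>B\<close>, acting by vector bundle isomorphisms. The second
  conjunct says both that \<open>b\<close> is a lift and that the projection is equivariant.
\<close>

definition lifted_action ::
    "('g, 'm) monoid_scheme \<Rightarrow> 'g cmanifold \<Rightarrow> ('g \<Rightarrow> 'a \<Rightarrow> 'a) \<Rightarrow> ('e, 'a) vbundle \<Rightarrow>
     ('g \<Rightarrow> 'e \<Rightarrow> 'e) \<Rightarrow> bool" where
  "lifted_action G T a B b \<longleftrightarrow>
     holomorphic_action G T (total B) b \<and>
     (\<forall>g\<in>carrier G. \<forall>e\<in>points (total B). proj B (b g e) = a g (proj B e)) \<and>
     (\<forall>g\<in>carrier G. \<forall>e\<in>points (total B). \<forall>f\<in>points (total B).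
        proj B e = proj B f \<longrightarrow> b g (badd B e f) = badd B (b g e) (b g f)) \<and>
     (\<forall>g\<in>carrier G. \<forall>c. \<forall>e\<in>points (total B). b g (bscale B c e) = bscale B c (b g e))"

definition T_spray ::
    "('g, 'm) monoid_scheme \<Rightarrow> 'g cmanifold \<Rightarrow> 'a cmanifold \<Rightarrow> ('g \<Rightarrow> 'a \<Rightarrow> 'a) \<Rightarrow>
     ('e, 'a) vbundle \<Rightarrow> ('e \<Rightarrow> 'a) \<Rightarrow> bool" where
  "T_spray G T X a B s \<longleftrightarrow>
     spray X B s \<and>
     (\<exists>b. lifted_action G T a B b \<and>
          (\<forall>g\<in>carrier G. \<forall>e\<in>points (total B). s (b g e) = a g (s e)))"

text \<open>
  HOL cannot quantify existentially over the type of points of the total space. Taking it to be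
  \<open>'a \<times> cvec\<close> loses no generality: a bundle of rank \<open>r\<close> over \<open>X\<close> is, as a set over \<open>X\<close>, in bijection
  with \<open>X \<times> \<complex>\<^sup>r\<close>, and its structure can be transported along any such bijection. Neither the
  points of the total space nor its topology, charts or operations are prescribed.
\<close>

definition T_elliptic ::
    "('g, 'm) monoid_scheme \<Rightarrow> 'g cmanifold \<Rightarrow> 'a cmanifold \<Rightarrow> ('g \<Rightarrow> 'a \<Rightarrow> 'a) \<Rightarrow> bool" where
  "T_elliptic G T X a \<longleftrightarrow>
     complex_lie_group G T \<and> complex_manifold X \<and> holomorphic_action G T X a \<and>
     (\<exists>(B :: ('a \<times> cvec, 'a) vbundle) s. T_spray G T X a B s \<and> dominating X B s)"

definition Cstar :: "complex monoid" where
  "Cstar = \<lparr>carrier = - {0}, mult = (*), one = 1\<rparr>"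

definition Cstar_manifold :: "complex cmanifold" where
  "Cstar_manifold =
     \<lparr>mtop = top_of_set (- {0}), mdim = 1, mcharts = {(- {0}, Poly_Mapping.single 0)}\<rparr>"

subsection \<open>Polynomials in several variables\<close>

text \<open>
  A monomial is the finitely supported map of its exponents, a polynomial the finitely supported
  map of its coefficients. Indices start at \<open>0\<close>: variable \<open>i\<close> is \<open>x\<^sub>i\<^sub>+\<^sub>1\<close>.
\<close>

type_synonym cpolynomial = "(nat \<Rightarrow>\<^sub>0 nat) \<Rightarrow>\<^sub>0 complex"

definition polynomials :: "nat \<Rightarrow> cpolynomial set" where
  "polynomials n = {p. \<forall>m\<in>Poly_Mapping.keys p. Poly_Mapping.keys m \<subseteq> {..<n}}"

definition degree_in :: "nat \<Rightarrow> cpolynomial \<Rightarrow> nat" where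
  "degree_in i p = Max (insert 0 ((\<lambda>m. Poly_Mapping.lookup m i) ` Poly_Mapping.keys p))"

definition peval :: "cpolynomial \<Rightarrow> (nat \<Rightarrow> complex) \<Rightarrow> complex" where
  "peval p x =
     (\<Sum>m\<in>Poly_Mapping.keys p. Poly_Mapping.lookup p m *
        (\<Prod>i\<in>Poly_Mapping.keys m. x i ^ Poly_Mapping.lookup m i))"

definition partial :: "nat \<Rightarrow> cpolynomial \<Rightarrow> cpolynomial" where
  "partial i p =
     (\<Sum>m\<in>Poly_Mapping.keys p.
        Poly_Mapping.single (m - Poly_Mapping.single i 1)
          (of_nat (Poly_Mapping.lookup m i) * Poly_Mapping.lookup p m))"

definition smooth_reduced_zero_set :: "nat \<Rightarrow> cpolynomial \<Rightarrow> bool" where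
  "smooth_reduced_zero_set n p \<longleftrightarrow>
     (\<forall>x\<in>Cn n. peval p (Poly_Mapping.lookup x) = 0 \<longrightarrow>
        (\<exists>i<n. peval (partial i p) (Poly_Mapping.lookup x) \<noteq> 0))"

subsection \<open>The hypersurface \<open>uv = p(x)\<close>\<close>

text \<open>The coordinates on \<open>\<complex>\<^sup>n\<^sup>+\<^sup>2\<close> are ordered as \<open>(u, v, x)\<close>: \<open>u\<close> and \<open>v\<close> have index \<open>0\<close> and \<open>1\<close>.\<close>

definition uv_hypersurface :: "nat \<Rightarrow> cpolynomial \<Rightarrow> cvec set" where
  "uv_hypersurface n p =
     {z \<in> Cn (n + 2). Poly_Mapping.lookup z 0 * Poly_Mapping.lookup z 1
                        - peval p (\<lambda>i. Poly_Mapping.lookup z (i + 2)) = 0}"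

definition uv_action :: "nat \<Rightarrow> complex \<Rightarrow> cvec \<Rightarrow> cvec" where
  "uv_action n t z =
     Poly_Mapping.single 0 (t * Poly_Mapping.lookup z 0) +
     Poly_Mapping.single 1 (inverse t * Poly_Mapping.lookup z 1) +
     (\<Sum>i<n. Poly_Mapping.single (i + 2) (Poly_Mapping.lookup z (i + 2)))"

end

(*  The defining function q = uv - p is affine in each of the n + 2 coordinates separately. Hence, for
    every pair of coordinates k, l, the Hamiltonian field (d_k q) d_l - (d_l q) d_k, which is tangent
    to X = {q = 0}, only moves the coordinates k and l, and restricted to these it is linear; so it
    is complete, with an explicit flow. At a point of X where d_m q does not vanish, the fields of the
    pairs (m, l) span the tangent space. The composition of all these flows is therefore a dominating
    spray on the trivial bundle with one coordinate for each pair. If the variables x_k have weights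
    w_k under the torus and q has weight 0, then the spray is equivariant when the torus acts on the
    fibre coordinate of the pair (k, l) with weight w_k + w_l.

    Solving q = 0 for the m-th coordinate gives explicit charts of X where d_m q does not vanish.  *)

theory Submission
  imports Defs "HOL-Complex_Analysis.Complex_Analysis"
begin

text \<open>The field of the pair (k, l) integrates in closed form because c = d_k d_l q involves
  neither x_k nor x_l: along the flow d_k q is multiplied by exp (s c) and d_l q by exp (- s c), and
  integrating these yields (exp y - 1) / y. The order of the flows is irrelevant for domination: all
  are the identity at time 0, so their derivatives at the zero vector add up. The weights arise
  because d_k q has weight - w_k: pushing the field forward by t multiplies it by t^(w_k + w_l),
  which the time has to absorb.

  The work lies elsewhere. The atlas of X consists of all local biholomorphic maps, that of a fibre
  of all linear isomorphisms, so domination has to be shown in charts of which nothing explicit is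
  known. Moreover \<open>Cn d\<close> has empty interior in the space of all finite sequences, so a
  derivative within it is not a derivative in the surrounding space. The remedy is to describe
  charts and their inverses by formulas in ambient coordinates that are differentiable in the whole
  space; truncating the argument produces such formulas.\<close>

section \<open>Coordinates on \<open>Cn d\<close> and the splitting of
  \<open>Cn (d + e)\<close>\<close>

abbreviation coord :: "cvec \<Rightarrow> nat \<Rightarrow> complex" where
  "coord \<equiv> Poly_Mapping.lookup"

abbreviation unit :: "nat \<Rightarrow> complex \<Rightarrow> cvec" where
  "unit \<equiv> Poly_Mapping.single"

text \<open>With \<open>f = coord y\<close> this is the truncation of \<open>y\<close>, a projection
  of the whole space onto \<open>Cn d\<close>; composing with it extends a map from
  \<open>Cn d\<close> to all sequences.\<close>

definition tuple :: "nat \<Rightarrow> (nat \<Rightarrow> complex) \<Rightarrow> cvec" where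
  "tuple d f = (\<Sum>i<d. unit i (f i))"

lemma coord_unit: "coord (unit i a) j = (if i = j then a else 0)"
  by (simp add: lookup_single when_def)

lemma coord_tuple [simp]: "coord (tuple d f) i = (if i < d then f i else 0)"
  by (simp add: tuple_def lookup_sum coord_unit)

lemma coord_cscale [simp]: "coord (cscale c x) i = c * coord x i"
  by (simp add: cscale_def Poly_Mapping.map.rep_eq when_def)

lemma in_Cn_iff: "x \<in> Cn d \<longleftrightarrow> (\<forall>i\<ge>d. coord x i = 0)"
  by (auto simp: Cn_def in_keys_iff subset_iff not_less) (metis not_le)

lemma tuple_in_Cn [simp]: "tuple d f \<in> Cn d"
  by (simp add: in_Cn_iff)

lemma tuple_coord: "x \<in> Cn d \<Longrightarrow> tuple d (coord x) = x"
  by (rule poly_mapping_eqI) (auto simp: in_Cn_iff)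

lemma zero_in_Cn [simp]: "0 \<in> Cn d"
  by (simp add: in_Cn_iff)

lemma add_in_Cn: "x \<in> Cn d \<Longrightarrow> y \<in> Cn d \<Longrightarrow> x + y \<in> Cn d"
  by (simp add: in_Cn_iff lookup_add)

lemma unit_in_Cn: "i < d \<Longrightarrow> unit i a \<in> Cn d"
  by (simp add: in_Cn_iff coord_unit)

lemma cscale_in_Cn: "x \<in> Cn d \<Longrightarrow> cscale c x \<in> Cn d"
  by (simp add: in_Cn_iff)

lemma coord_cat: "coord (cat d x y) j = coord x j + (if d \<le> j then coord y (j - d) else 0)"
proof -
  have "coord (cat d x y) j
      = coord x j + (\<Sum>i\<in>Poly_Mapping.keys y. if d + i = j then coord y i else 0)"
    by (simp add: cat_def lookup_add lookup_sum coord_unit)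
  also have "(\<Sum>i\<in>Poly_Mapping.keys y. if d + i = j then coord y i else 0)
      = (\<Sum>i\<in>Poly_Mapping.keys y. if i = j - d then (if d \<le> j then coord y i else 0) else 0)"
    by (intro sum.cong) auto
  also have "\<dots> = (if d \<le> j then coord y (j - d) else 0)"
    by (simp add: in_keys_iff)
  finally show ?thesis .
qed

lemma cat_eq_tuple:
  assumes "x \<in> Cn d" "y \<in> Cn e"
  shows "cat d x y = tuple (d + e) (\<lambda>i. if i < d then coord x i else coord y (i - d))"
  using assms by (intro poly_mapping_eqI) (auto simp: coord_cat in_Cn_iff)

lemma cat_in_Cn: "x \<in> Cn d \<Longrightarrow> y \<in> Cn e \<Longrightarrow> cat d x y \<in> Cn (d + e)"
  by (simp add: cat_eq_tuple)

text \<open>The second projection belonging to \<open>cat\<close>, the first being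
  \<open>tuple d (coord z)\<close>. Both are defined on all sequences, so they can be differentiated
  there.\<close>

definition rest :: "nat \<Rightarrow> nat \<Rightarrow> cvec \<Rightarrow> cvec" where
  "rest d e z = tuple e (\<lambda>i. coord z (d + i))"

lemma tuple_cat: "x \<in> Cn d \<Longrightarrow> tuple d (coord (cat d x y)) = x"
  by (rule poly_mapping_eqI) (auto simp: coord_cat in_Cn_iff)

lemma rest_cat: "x \<in> Cn d \<Longrightarrow> y \<in> Cn e \<Longrightarrow> rest d e (cat d x y) = y"
  by (rule poly_mapping_eqI) (auto simp: rest_def cat_eq_tuple in_Cn_iff)

lemma cat_tuple_rest:
  assumes "z \<in> Cn (d + e)"
  shows "cat d (tuple d (coord z)) (rest d e z) = z"
proof (rule poly_mapping_eqI)
  show "coord (cat d (tuple d (coord z)) (rest d e z)) j = coord z j" for j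
    unfolding rest_def cat_eq_tuple[OF tuple_in_Cn tuple_in_Cn] using assms by (auto simp: in_Cn_iff)
qed

lemma rest_in_Cn [simp]: "rest d e z \<in> Cn e"
  by (simp add: rest_def)

text \<open>The space is infinite-dimensional, so linearity alone does not give continuity; the norm
  is the sum of the absolute values of the coordinates and dominates each of them.\<close>

lemma bounded_linear_coord: "bounded_linear (\<lambda>x. coord x i)"
proof (rule bounded_linear_intro[where K = 1])
  fix x :: cvec
  have "norm x = (\<Sum>n\<in>Poly_Mapping.keys x. norm (coord x n))"
    by (simp add: norm_poly_mapping_def dist_poly_mapping_def)
  moreover have "norm (coord x i) \<le> (\<Sum>n\<in>Poly_Mapping.keys x. norm (coord x n))"
    by (cases "i \<in> Poly_Mapping.keys x")
      (auto intro: member_le_sum sum_nonneg simp: in_keys_iff)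
  ultimately show "norm (coord x i) \<le> norm x * 1"
    by simp
qed (simp_all add: lookup_add scaleR_poly_mapping_def)

lemma bounded_linear_unit: "bounded_linear (unit i)"
proof (rule bounded_linear_intro[where K = 1])
  show "norm (unit i a) \<le> norm a * 1" for a
    by (simp add: norm_poly_mapping_def dist_poly_mapping_def)
  show "unit i (r *\<^sub>R a) = r *\<^sub>R unit i a" for r a
    by (rule poly_mapping_eqI) (simp add: scaleR_poly_mapping_def coord_unit)
qed (simp add: single_add)

lemma scaleR_eq_cscale: "r *\<^sub>R x = cscale (complex_of_real r) x"
  by (rule poly_mapping_eqI) (simp add: scaleR_poly_mapping_def scaleR_conv_of_real)

subsection \<open>Holomorphic functions at a point\<close>

definition shol_at :: "(cvec \<Rightarrow> complex) \<Rightarrow> cvec \<Rightarrow> bool" where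
  "shol_at f x \<longleftrightarrow>
     (\<exists>D. (f has_derivative D) (at x) \<and> (\<forall>c h. D (cscale c h) = c * D h))"

text \<open>The derivative is taken in the whole space, not within a subset of \<open>Cn d\<close>;
  so the chain rule needs no condition on images, and derivatives are unique in all
  directions.\<close>

definition has_cderiv :: "(cvec \<Rightarrow> cvec) \<Rightarrow> (cvec \<Rightarrow> cvec) \<Rightarrow> cvec \<Rightarrow> bool" where
  "has_cderiv f D x \<longleftrightarrow> (f has_derivative D) (at x) \<and> (\<forall>c h. D (cscale c h) = cscale c (D h))"

text \<open>A condition at the single point \<open>x\<close>, not near it. This is enough for the
  chain rule; holomorphy is recovered by asking for it at every point of an open set.\<close>

definition vhol_at :: "(cvec \<Rightarrow> cvec) \<Rightarrow> cvec \<Rightarrow> bool" where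
  "vhol_at f x \<longleftrightarrow> (\<exists>D. has_cderiv f D x)"

lemma has_cderiv_compose:
  "has_cderiv f D x \<Longrightarrow> has_cderiv g E (f x) \<Longrightarrow> has_cderiv (\<lambda>y. g (f y)) (\<lambda>h. E (D h)) x"
  unfolding has_cderiv_def using has_derivative_compose[of f D x UNIV g E] by simp

lemma shol_at_const: "shol_at (\<lambda>y. c) x"
  unfolding shol_at_def by (intro exI[of _ "\<lambda>_. 0"]) auto

lemma shol_at_coord: "shol_at (\<lambda>y. coord y i) x"
  unfolding shol_at_def
  by (intro exI[of _ "\<lambda>h. coord h i"]) (auto intro: bounded_linear_imp_has_derivative bounded_linear_coord)

lemma shol_at_add: "shol_at f x \<Longrightarrow> shol_at g x \<Longrightarrow> shol_at (\<lambda>y. f y + g y) x"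
  unfolding shol_at_def
proof (elim exE conjE, goal_cases)
  case (1 D E)
  then show ?case
    by (intro exI[of _ "\<lambda>h. D h + E h"]) (auto intro!: has_derivative_add simp: distrib_left)
qed

lemma shol_at_mult: "shol_at f x \<Longrightarrow> shol_at g x \<Longrightarrow> shol_at (\<lambda>y. f y * g y) x"
  unfolding shol_at_def
proof (elim exE conjE, goal_cases)
  case (1 D E)
  then show ?case
    by (intro exI[of _ "\<lambda>h. f x * E h + D h * g x"] conjI has_derivative_mult)
      (simp_all add: algebra_simps)
qed

lemma shol_at_compose:
  "shol_at g (f x) \<Longrightarrow> vhol_at f x \<Longrightarrow> shol_at (\<lambda>y. g (f y)) x"
  unfolding shol_at_def vhol_at_def has_cderiv_def
proof (elim exE conjE, goal_cases)
  case (1 D E)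
  then show ?case
    using has_derivative_compose[of f E x UNIV g D] by (intro exI[of _ "\<lambda>h. D (E h)"]) auto
qed

lemma shol_at_field:
  "shol_at f x \<Longrightarrow> g field_differentiable (at (f x)) \<Longrightarrow> shol_at (\<lambda>y. g (f y)) x"
  unfolding shol_at_def field_differentiable_def has_field_derivative_def
proof (elim exE conjE, goal_cases)
  case (1 D E)
  then show ?case
    using has_derivative_compose[of f D x UNIV g "(*) E"]
    by (intro exI[of _ "\<lambda>h. E * D h"]) auto
qed

lemma shol_at_uminus: "shol_at f x \<Longrightarrow> shol_at (\<lambda>y. - f y) x"
  using shol_at_mult[OF shol_at_const[of "-1"]] by simp

lemma shol_at_diff: "shol_at f x \<Longrightarrow> shol_at g x \<Longrightarrow> shol_at (\<lambda>y. f y - g y) x"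
  using shol_at_add[of f x "\<lambda>y. - g y"] shol_at_uminus by simp

lemma shol_at_power: "shol_at f x \<Longrightarrow> shol_at (\<lambda>y. f y ^ k) x"
  by (induction k) (auto intro: shol_at_mult shol_at_const)

lemma shol_at_divide:
  assumes "shol_at f x" "shol_at g x" "g x \<noteq> 0"
  shows "shol_at (\<lambda>y. f y / g y) x"
proof -
  have "(\<lambda>z. inverse z) field_differentiable (at (g x))"
    using assms(3) field_differentiable_inverse[of "\<lambda>z. z" "g x" UNIV]
    by (simp add: field_differentiable_ident)
  then show ?thesis
    using shol_at_mult[OF assms(1) shol_at_field[OF assms(2)]] by (simp add: divide_inverse)
qed

lemma shol_at_sum: "(\<And>i. i \<in> I \<Longrightarrow> shol_at (f i) x) \<Longrightarrow> shol_at (\<lambda>y. \<Sum>i\<in>I. f i y) x"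
  by (induction I rule: infinite_finite_induct) (auto intro: shol_at_add shol_at_const)

lemma shol_at_prod: "(\<And>i. i \<in> I \<Longrightarrow> shol_at (f i) x) \<Longrightarrow> shol_at (\<lambda>y. \<Prod>i\<in>I. f i y) x"
  by (induction I rule: infinite_finite_induct) (auto intro: shol_at_mult shol_at_const)

lemma has_cderiv_id: "has_cderiv (\<lambda>y. y) (\<lambda>h. h) x"
  by (simp add: has_cderiv_def)

lemma has_cderiv_const: "has_cderiv (\<lambda>y. a) (\<lambda>h. 0) x"
  by (auto simp: has_cderiv_def intro!: poly_mapping_eqI)

lemma has_cderiv_add:
  "has_cderiv f D x \<Longrightarrow> has_cderiv g E x \<Longrightarrow> has_cderiv (\<lambda>y. f y + g y) (\<lambda>h. D h + E h) x"
  by (auto simp: has_cderiv_def lookup_add distrib_left intro!: has_derivative_add poly_mapping_eqI)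

lemma has_cderiv_sum:
  "(\<And>i. i \<in> I \<Longrightarrow> has_cderiv (f i) (D i) x) \<Longrightarrow>
    has_cderiv (\<lambda>y. \<Sum>i\<in>I. f i y) (\<lambda>h. \<Sum>i\<in>I. D i h) x"
  by (induction I rule: infinite_finite_induct) (auto intro: has_cderiv_add has_cderiv_const)

lemma has_cderiv_unit:
  assumes "(f has_derivative D) (at x)" "\<And>c h. D (cscale c h) = c * D h"
  shows "has_cderiv (\<lambda>y. unit i (f y)) (\<lambda>h. unit i (D h)) x"
  using has_derivative_compose[OF assms(1) bounded_linear_imp_has_derivative[OF bounded_linear_unit]]
  by (auto simp: has_cderiv_def assms(2) coord_unit intro!: poly_mapping_eqI)

lemma has_cderiv_trunc: "has_cderiv (\<lambda>y. tuple d (coord y)) (\<lambda>y. tuple d (coord y)) x"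
  unfolding tuple_def
  by (intro has_cderiv_sum has_cderiv_unit bounded_linear_imp_has_derivative bounded_linear_coord)
    simp

lemma vhol_at_compose: "vhol_at g (f x) \<Longrightarrow> vhol_at f x \<Longrightarrow> vhol_at (\<lambda>y. g (f y)) x"
  unfolding vhol_at_def using has_cderiv_compose by blast

lemma vhol_at_id: "vhol_at (\<lambda>y. y) x"
  unfolding vhol_at_def using has_cderiv_id by blast

lemma vhol_at_const: "vhol_at (\<lambda>y. a) x"
  unfolding vhol_at_def using has_cderiv_const by blast

lemma vhol_at_add: "vhol_at f x \<Longrightarrow> vhol_at g x \<Longrightarrow> vhol_at (\<lambda>y. f y + g y) x"
  unfolding vhol_at_def using has_cderiv_add by blast

lemma vhol_at_unit: "shol_at f x \<Longrightarrow> vhol_at (\<lambda>y. unit i (f y)) x"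
  unfolding vhol_at_def shol_at_def by (blast intro: has_cderiv_unit)

lemma vhol_at_sum: "(\<And>i. i \<in> I \<Longrightarrow> vhol_at (f i) x) \<Longrightarrow> vhol_at (\<lambda>y. \<Sum>i\<in>I. f i y) x"
  by (induction I rule: infinite_finite_induct) (auto intro: vhol_at_add vhol_at_const)

lemma vhol_at_tuple: "(\<And>i. i < d \<Longrightarrow> shol_at (f i) x) \<Longrightarrow> vhol_at (\<lambda>y. tuple d (\<lambda>i. f i y)) x"
  unfolding tuple_def by (intro vhol_at_sum vhol_at_unit) auto

lemma vhol_at_trunc: "vhol_at (\<lambda>y. tuple d (coord y)) x"
  unfolding vhol_at_def using has_cderiv_trunc by blast

lemma vhol_at_rest: "vhol_at (rest d e) x"
  unfolding rest_def[abs_def] by (intro vhol_at_tuple shol_at_coord)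

lemma shol_at_coord_vhol: "vhol_at f x \<Longrightarrow> shol_at (\<lambda>y. coord (f y) i) x"
  by (rule shol_at_compose[OF shol_at_coord])

lemma vhol_at_isCont: "vhol_at f x \<Longrightarrow> isCont f x"
  unfolding vhol_at_def has_cderiv_def using has_derivative_continuous by blast

lemma shol_at_isCont: "shol_at f x \<Longrightarrow> isCont f x"
  unfolding shol_at_def using has_derivative_continuous by blast

section \<open>Passing between derivatives within \<open>Cn d\<close> and derivatives in the whole
  space\<close>

lemma has_derivative_line:
  assumes "(f has_derivative D) (at x)"
  shows "((\<lambda>t::real. f (x + t *\<^sub>R h)) has_derivative (\<lambda>t. D (t *\<^sub>R h))) (at 0)"
proof -
  have "((\<lambda>t::real. x + t *\<^sub>R h) has_derivative (\<lambda>t. t *\<^sub>R h)) (at 0)"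
    by (auto intro!: derivative_eq_intros)
  from has_derivative_compose[OF this, of f D] show ?thesis
    using assms by simp
qed

text \<open>\<open>f\<close> and \<open>g\<close> agree only on a set with empty interior in the
  whole space, so \<open>D\<close> and \<open>E\<close> may differ. In a direction \<open>h\<close>
  of \<open>Cn d\<close>, however, the line through \<open>x\<close> stays in \<open>S\<close> for
  small times, and there derivatives in one real variable are compared.\<close>

lemma derivative_unique_Cn:
  fixes f g :: "cvec \<Rightarrow> 'b::real_normed_vector"
  assumes f: "(f has_derivative D) (at x)" and g: "(g has_derivative E) (at x)"
    and S: "openin (top_of_set (Cn d)) S" "x \<in> S" and eq: "\<And>y. y \<in> S \<Longrightarrow> f y = g y"
    and h: "h \<in> Cn d"
  shows "D h = E h"
proof -
  obtain T where T: "open T" "S = Cn d \<inter> T"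
    using S(1) openin_open by blast
  let ?l = "\<lambda>t::real. x + t *\<^sub>R h"
  have "continuous_on UNIV ?l"
    by (intro continuous_intros)
  then have op: "open (?l -` T)"
    using T(1) by (simp add: continuous_on_open_vimage)
  have 0: "0 \<in> ?l -` T"
    using S(2) T(2) by simp
  have "?l t \<in> Cn d" for t
    using S(2) T(2) h by (auto simp: scaleR_eq_cscale intro!: add_in_Cn cscale_in_Cn)
  then have *: "f (?l t) = g (?l t)" if "t \<in> ?l -` T" for t
    using that T(2) by (intro eq) auto
  have "((\<lambda>t. g (?l t)) has_derivative (\<lambda>t. D (t *\<^sub>R h))) (at 0)"
    by (rule has_derivative_transform_within_open[OF has_derivative_line[OF f, of h] op 0 *])
  then have "(\<lambda>t::real. D (t *\<^sub>R h)) = (\<lambda>t. E (t *\<^sub>R h))"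
    using has_derivative_line[OF g, of h] has_derivative_unique by blast
  from fun_cong[OF this, of 1] show ?thesis
    by simp
qed

text \<open>The truncation maps a full neighbourhood of \<open>x\<close> into \<open>S\<close>, so
  the chain rule turns the derivative within \<open>S\<close> into a derivative in the whole
  space.\<close>

lemma vhol_at_of_cholomorphic:
  assumes "cholomorphic d S f" "x \<in> S"
  shows "vhol_at (\<lambda>y. f (tuple d (coord y))) x"
proof -
  let ?t = "\<lambda>y. tuple d (coord y)"
  from assms obtain D where D: "(f has_derivative D) (at x within S)"
      "\<And>c h. h \<in> Cn d \<Longrightarrow> D (cscale c h) = cscale c (D h)"
    and op: "openin (top_of_set (Cn d)) S"
    unfolding cholomorphic_def has_complex_derivative_def by blast
  have xt: "?t x = x"
    using assms(2) op openin_imp_subset by (blast intro: tuple_coord)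
  obtain T where T: "open T" "S = Cn d \<inter> T"
    using op openin_open by blast
  have "continuous_on UNIV ?t"
    using vhol_at_isCont[OF vhol_at_trunc] by (simp add: continuous_at_imp_continuous_on)
  then have *: "open (?t -` T)"
    using T(1) by (simp add: continuous_on_open_vimage)
  have "(?t has_derivative ?t) (at x within ?t -` T)"
    using has_cderiv_trunc has_derivative_at_withinI unfolding has_cderiv_def by blast
  moreover have "(f has_derivative D) (at (?t x) within ?t ` (?t -` T))"
    unfolding xt using D(1) by (rule has_derivative_subset) (use T(2) in auto)
  ultimately have "((\<lambda>y. f (?t y)) has_derivative (\<lambda>h. D (?t h))) (at x within ?t -` T)"
    by (rule has_derivative_in_compose)
  moreover have "x \<in> ?t -` T"
    using xt assms(2) T(2) by simp
  ultimately have "((\<lambda>y. f (?t y)) has_derivative (\<lambda>h. D (?t h))) (at x)"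
    using at_within_open[OF _ *] by metis
  moreover have "?t (cscale c h) = cscale c (?t h)" for c h
    by (rule poly_mapping_eqI) simp
  ultimately have "has_cderiv (\<lambda>y. f (?t y)) (\<lambda>h. D (?t h)) x"
    by (simp add: has_cderiv_def D(2))
  then show ?thesis
    unfolding vhol_at_def by blast
qed

lemma has_complex_derivative_of_cderiv:
  assumes "has_cderiv g D x" "x \<in> S" "\<forall>\<^sub>F y in at x within S. f y = g y" "f x = g x"
  shows "has_complex_derivative d S f x D"
proof -
  have "(g has_derivative D) (at x within S)"
    using assms(1) has_derivative_at_withinI unfolding has_cderiv_def by blast
  then have "(f has_derivative D) (at x within S)"
    by (rule has_derivative_transform_eventually)
      (use assms(2-4) in \<open>auto elim: eventually_mono\<close>)
  then show ?thesis
    using assms(1) by (simp add: has_complex_derivative_def has_cderiv_def)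
qed

lemma cholomorphic_of_vhol:
  assumes "openin (top_of_set (Cn d)) S" "\<And>x. x \<in> S \<Longrightarrow> vhol_at g x" "\<And>x. x \<in> S \<Longrightarrow> f x = g x"
  shows "cholomorphic d S f"
  unfolding cholomorphic_def
proof (intro conjI ballI)
  fix x assume x: "x \<in> S"
  then obtain D where "has_cderiv g D x"
    using assms(2) vhol_at_def by blast
  then show "\<exists>D. has_complex_derivative d S f x D"
    using has_complex_derivative_of_cderiv[of g D x S f d] x assms(3)
    by (auto simp: eventually_at_filter)
qed (fact assms(1))

text \<open>On sequences vanishing from \<open>d\<close> on, the norm topology is the topology of
  coordinatewise convergence, because \<open>tuple d\<close> is a finite sum of continuous maps. The
  product topology on all sequences has a countable basis.\<close>

lemma second_countable_Cn: "second_countable (top_of_set (Cn d))"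
proof -
  have "homeomorphic_maps (top_of_set {f :: nat \<Rightarrow> complex. \<forall>i\<ge>d. f i = 0}) (top_of_set (Cn d))
      (tuple d) coord"
    unfolding homeomorphic_maps_def
  proof (intro conjI ballI)
    have "continuous_on {f. \<forall>i\<ge>d. f i = 0} (tuple d)"
      unfolding tuple_def[abs_def]
      by (intro continuous_on_sum bounded_linear.continuous_on[OF bounded_linear_unit]
          continuous_on_subset[OF continuous_on_product_coordinates] subset_UNIV)
    then show "continuous_map (top_of_set {f. \<forall>i\<ge>d. f i = 0}) (top_of_set (Cn d)) (tuple d)"
      by auto
    have "continuous_on (Cn d) coord"
      by (rule continuous_on_coordinatewise_then_product)
        (intro linear_continuous_on bounded_linear_coord)
    then show "continuous_map (top_of_set (Cn d)) (top_of_set {f. \<forall>i\<ge>d. f i = 0}) coord"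
      by (auto simp: in_Cn_iff)
  qed (auto simp: tuple_coord fun_eq_iff)
  then have "top_of_set {f :: nat \<Rightarrow> complex. \<forall>i\<ge>d. f i = 0} homeomorphic_space top_of_set (Cn d)"
    unfolding homeomorphic_space_def by blast
  moreover have "second_countable (euclidean :: (nat \<Rightarrow> complex) topology)"
  proof -
    obtain \<B> :: "(nat \<Rightarrow> complex) set set" where \<B>: "countable \<B>" "topological_basis \<B>"
      using ex_countable_basis by blast
    show ?thesis
      unfolding second_countable_def open_openin[symmetric]
    proof (intro exI[of _ \<B>] conjI ballI allI impI)
      show "open V" if "V \<in> \<B>" for V
        using \<B>(2) that by (rule topological_basis_open)
      fix U :: "(nat \<Rightarrow> complex) set" and x
      assume "open U \<and> x \<in> U"
      then obtain V where "V \<in> \<B>" "x \<in> V" "V \<subseteq> U"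
        using topological_basisE[OF \<B>(2)] by metis
      then show "\<exists>V\<in>\<B>. x \<in> V \<and> V \<subseteq> U"
        by blast
    qed (fact \<B>(1))
  qed
  ultimately have "second_countable (top_of_set (Cn d))"
    using homeomorphic_space_second_countability second_countable_subtopology by blast
  then show ?thesis .
qed

subsection \<open>Manifolds embedded in \<open>\<complex>\<^sup>N\<close>\<close>

text \<open>All manifolds below come with an embedding into some \<open>Cn N\<close> in terms of whose coordinates the
  charts and their inverses are holomorphic. Maps between them are then recognised as holomorphic
  by a formula in the ambient coordinates, without reference to charts.\<close>

definition chart_via :: "'a cmanifold \<Rightarrow> ('a \<Rightarrow> cvec) \<Rightarrow> 'a set \<Rightarrow> ('a \<Rightarrow> cvec) \<Rightarrow> bool" where
  "chart_via M \<iota> U \<phi> \<longleftrightarrow>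
     openin (mtop M) U \<and> inj_on \<phi> U \<and> openin (top_of_set (Cn (mdim M))) (\<phi> ` U) \<and>
     (\<forall>x\<in>U. \<exists>W F. open W \<and> \<iota> x \<in> W \<and> (\<forall>y\<in>W. vhol_at F y) \<and>
        (\<forall>x'\<in>U. \<iota> x' \<in> W \<longrightarrow> \<phi> x' = F (\<iota> x'))) \<and>
     (\<exists>G. \<forall>x\<in>U. vhol_at G (\<phi> x) \<and> G (\<phi> x) = \<iota> x)"

lemma chart_via_local:
  assumes "chart_via M \<iota> U \<phi>" "x \<in> U"
  obtains W F where "open W" "\<iota> x \<in> W" "\<And>y. y \<in> W \<Longrightarrow> vhol_at F y"
    "\<And>x'. x' \<in> U \<Longrightarrow> \<iota> x' \<in> W \<Longrightarrow> \<phi> x' = F (\<iota> x')"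
proof -
  have "\<exists>W F. open W \<and> \<iota> x \<in> W \<and> (\<forall>y\<in>W. vhol_at F y) \<and>
      (\<forall>x'\<in>U. \<iota> x' \<in> W \<longrightarrow> \<phi> x' = F (\<iota> x'))"
    using assms unfolding chart_via_def by (elim conjE bspec)
  then show ?thesis
    by (elim exE conjE) (rule that, assumption+, (erule (1) bspec)+, simp)
qed

definition embedded :: "'a cmanifold \<Rightarrow> nat \<Rightarrow> ('a \<Rightarrow> cvec) \<Rightarrow> bool" where
  "embedded M N \<iota> \<longleftrightarrow>
     \<iota> ` points M \<subseteq> Cn N \<and> continuous_map (mtop M) euclidean \<iota> \<and>
     (\<exists>\<kappa>. continuous_map (top_of_set (\<iota> ` points M)) (mtop M) \<kappa> \<and> (\<forall>x\<in>points M. \<kappa> (\<iota> x) = x)) \<and>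
     (\<Union>(U, \<phi>)\<in>mcharts M. U) = points M \<and>
     (\<forall>(U, \<phi>)\<in>mcharts M. chart_via M \<iota> U \<phi>)"

lemma embeddedD:
  assumes "embedded M N \<iota>"
  shows "\<iota> ` points M \<subseteq> Cn N" "continuous_map (mtop M) euclidean \<iota>"
    "(\<Union>(U, \<phi>)\<in>mcharts M. U) = points M"
  using assms by (simp_all add: embedded_def)

lemma embedded_homeomorphic_maps:
  assumes "embedded M N \<iota>"
  obtains \<kappa> where "homeomorphic_maps (mtop M) (top_of_set (\<iota> ` points M)) \<iota> \<kappa>"
proof -
  have "\<exists>\<kappa>. continuous_map (top_of_set (\<iota> ` points M)) (mtop M) \<kappa> \<and> (\<forall>x\<in>points M. \<kappa> (\<iota> x) = x)"
    using assms unfolding embedded_def by (elim conjE)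
  then obtain \<kappa> where \<kappa>: "continuous_map (top_of_set (\<iota> ` points M)) (mtop M) \<kappa>"
      "\<forall>x\<in>points M. \<kappa> (\<iota> x) = x"
    by (elim exE conjE)
  have "homeomorphic_maps (mtop M) (top_of_set (\<iota> ` points M)) \<iota> \<kappa>"
    unfolding homeomorphic_maps_def using \<kappa> embeddedD(2)[OF assms]
    by (simp add: continuous_map_in_subtopology)
  then show ?thesis
    by (rule that)
qed

lemma embedded_inj:
  assumes "embedded M N \<iota>"
  shows "inj_on \<iota> (points M)"
proof -
  obtain \<kappa> where "homeomorphic_maps (mtop M) (top_of_set (\<iota> ` points M)) \<iota> \<kappa>"
    using embedded_homeomorphic_maps[OF assms] .
  then show ?thesis
    unfolding homeomorphic_maps_def by (intro inj_on_inverseI[of _ \<kappa>]) simp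
qed

lemma embedded_chart: "embedded M N \<iota> \<Longrightarrow> (U, \<phi>) \<in> mcharts M \<Longrightarrow> chart_via M \<iota> U \<phi>"
  unfolding embedded_def by (elim conjE) (drule (1) bspec, simp)

text \<open>Since \<open>\<iota>\<close> is injective, the image of \<open>A\<close> under the chart
  is the preimage, under the continuous inverse formula \<open>G\<close>, of the relatively open set
  of all \<open>\<iota> a\<close> with \<open>a\<close> in \<open>A\<close>.\<close>

lemma chart_image_open:
  assumes M: "embedded M N \<iota>" and U: "chart_via M \<iota> U \<phi>" and A: "openin (mtop M) A" "A \<subseteq> U"
  shows "openin (top_of_set (Cn (mdim M))) (\<phi> ` A)"
proof -
  obtain \<kappa> where \<kappa>: "homeomorphic_maps (mtop M) (top_of_set (\<iota> ` points M)) \<iota> \<kappa>"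
    using embedded_homeomorphic_maps[OF M] .
  from U obtain G where G: "\<And>x. x \<in> U \<Longrightarrow> vhol_at G (\<phi> x)" "\<And>x. x \<in> U \<Longrightarrow> G (\<phi> x) = \<iota> x"
    and op: "openin (top_of_set (Cn (mdim M))) (\<phi> ` U)" and UM: "openin (mtop M) U"
    unfolding chart_via_def by blast
  have UsM: "U \<subseteq> points M"
    using UM openin_subset by blast
  have "openin (top_of_set (\<iota> ` points M)) (\<iota> ` A)"
    using homeomorphic_maps_imp_map[OF \<kappa>] A(1)
    by (meson homeomorphic_map_openness_eq)
  moreover have "continuous_on (\<phi> ` U) G"
    using G(1) by (auto intro!: continuous_at_imp_continuous_on vhol_at_isCont)
  moreover have "G ` \<phi> ` U \<subseteq> \<iota> ` points M"
    using G(2) UsM by auto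
  ultimately have "openin (top_of_set (\<phi> ` U)) (\<phi> ` U \<inter> G -` (\<iota> ` A))"
    by (meson continuous_openin_preimage image_subset_iff_funcset)
  moreover have "\<phi> ` U \<inter> G -` (\<iota> ` A) = \<phi> ` A"
  proof -
    have "x \<in> A" if "x \<in> U" "a \<in> A" "\<iota> x = \<iota> a" for x a
      using inj_onD[OF embedded_inj[OF M] that(3)] that(1,2) A(2) UsM by auto
    then show ?thesis
      using G(2) A(2) by auto
  qed
  ultimately show ?thesis
    using op openin_trans by metis
qed

text \<open>On the points, \<open>f\<close> is \<open>F\<close> between the two embeddings followed
  by the continuous left inverse of \<open>\<iota>'\<close>.\<close>

lemma continuous_map_embedded:
  assumes M: "embedded M N \<iota>" and M': "embedded M' N' \<iota>'"
    and f: "\<And>x. x \<in> points M \<Longrightarrow> f x \<in> points M'"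
    and F: "\<And>x. x \<in> points M \<Longrightarrow> vhol_at F (\<iota> x)" "\<And>x. x \<in> points M \<Longrightarrow> \<iota>' (f x) = F (\<iota> x)"
  shows "continuous_map (mtop M) (mtop M') f"
proof -
  obtain \<kappa> where \<kappa>: "homeomorphic_maps (mtop M) (top_of_set (\<iota> ` points M)) \<iota> \<kappa>"
    using embedded_homeomorphic_maps[OF M] .
  obtain \<kappa>' where \<kappa>': "homeomorphic_maps (mtop M') (top_of_set (\<iota>' ` points M')) \<iota>' \<kappa>'"
    using embedded_homeomorphic_maps[OF M'] .
  have "continuous_on (\<iota> ` points M) F"
    using F(1) by (auto intro!: continuous_at_imp_continuous_on vhol_at_isCont)
  moreover have "F \<in> \<iota> ` points M \<rightarrow> \<iota>' ` points M'"
    using F(2) f by force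
  ultimately have "continuous_map (top_of_set (\<iota> ` points M)) (top_of_set (\<iota>' ` points M')) F"
    by simp
  then have "continuous_map (mtop M) (mtop M') (\<kappa>' \<circ> (F \<circ> \<iota>))"
    using \<kappa> \<kappa>' unfolding homeomorphic_maps_def by (meson continuous_map_compose)
  then show ?thesis
    by (rule continuous_map_eq) (use F(2)[symmetric] f \<kappa>' in \<open>simp add: homeomorphic_maps_def\<close>)
qed

text \<open>Read in charts, \<open>f\<close> is \<open>H\<close> after \<open>F\<close> after
  \<open>G\<close>, where \<open>G\<close> inverts the source chart and \<open>H\<close> is the
  ambient formula of the target chart.\<close>

lemma vhol_in_charts:
  assumes U: "chart_via M \<iota> U \<phi>" and V: "chart_via M' \<iota>' V \<psi>"
    and F: "vhol_at F (\<iota> x)" "\<And>x. x \<in> points M \<Longrightarrow> \<iota>' (f x) = F (\<iota> x)"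
    and x: "x \<in> U" "f x \<in> V"
  shows "\<exists>D. has_complex_derivative (mdim M) (\<phi> ` {x \<in> U. f x \<in> V}) (\<psi> \<circ> f \<circ> inv_into U \<phi>) (\<phi> x) D"
proof -
  let ?S = "\<phi> ` {x \<in> U. f x \<in> V}"
  have UsM: "U \<subseteq> points M" and inj: "inj_on \<phi> U"
    using U openin_subset unfolding chart_via_def by blast+
  obtain G where G: "\<And>x. x \<in> U \<Longrightarrow> vhol_at G (\<phi> x)" "\<And>x. x \<in> U \<Longrightarrow> G (\<phi> x) = \<iota> x"
    using U unfolding chart_via_def by blast
  obtain W H where W: "open W" "\<iota>' (f x) \<in> W" and H: "\<And>y. y \<in> W \<Longrightarrow> vhol_at H y"
    "\<And>x'. x' \<in> V \<Longrightarrow> \<iota>' x' \<in> W \<Longrightarrow> \<psi> x' = H (\<iota>' x')"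
    using chart_via_local[OF V x(2)] by blast
  have eq: "F (G (\<phi> x')) = \<iota>' (f x')" if "x' \<in> U" for x'
    using that UsM G(2) F(2) by auto
  have FG: "vhol_at (\<lambda>y. F (G y)) (\<phi> x)"
    using x(1) G F(1) vhol_at_compose[of F G "\<phi> x"] by simp
  then have "vhol_at (\<lambda>y. H (F (G y))) (\<phi> x)"
    using W(2) x(1) eq H(1) vhol_at_compose[of H "\<lambda>y. F (G y)" "\<phi> x"] by simp
  then obtain D where D: "has_cderiv (\<lambda>y. H (F (G y))) D (\<phi> x)"
    unfolding vhol_at_def by blast
  have "has_complex_derivative (mdim M) ?S (\<psi> \<circ> f \<circ> inv_into U \<phi>) (\<phi> x) D"
  proof (rule has_complex_derivative_of_cderiv[OF D])
    \<comment> \<open>The formula \<open>H\<close> represents \<open>\<psi>\<close> only on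
      \<open>W\<close>, so the identity with the chart expression is available only near
      \<open>\<phi> x\<close>; a derivative needs no more.\<close>
    have "\<forall>\<^sub>F y in nhds (\<phi> x). F (G y) \<in> W"
      using vhol_at_isCont[OF FG] W eq[OF x(1)]
      by (auto simp: continuous_at_open eventually_nhds)
    then show "\<forall>\<^sub>F y in at (\<phi> x) within ?S. (\<psi> \<circ> f \<circ> inv_into U \<phi>) y = H (F (G y))"
      unfolding eventually_at_filter
      by (rule eventually_mono) (auto simp: inj eq H(2))
    show "(\<psi> \<circ> f \<circ> inv_into U \<phi>) (\<phi> x) = H (F (G (\<phi> x)))"
      using x W(2) by (simp add: inj eq H(2))
  qed (use x in auto)
  then show ?thesis
    by (intro exI[where x = D])
qed

text \<open>The criterion by which the maps of the construction are recognised as holomorphic: one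
  formula \<open>F\<close> in ambient coordinates, differentiable at the embedded points, serves all
  pairs of charts at once.\<close>

lemma holomorphic_map_embedded:
  assumes M: "embedded M N \<iota>" and M': "embedded M' N' \<iota>'"
    and f: "\<And>x. x \<in> points M \<Longrightarrow> f x \<in> points M'"
    and F: "\<And>x. x \<in> points M \<Longrightarrow> vhol_at F (\<iota> x)" "\<And>x. x \<in> points M \<Longrightarrow> \<iota>' (f x) = F (\<iota> x)"
  shows "holomorphic_map M M' f"
proof -
  have cont: "continuous_map (mtop M) (mtop M') f"
    by (rule continuous_map_embedded[OF M M', where F = F]) (simp_all add: f F)
  have holo: "cholomorphic (mdim M) (\<phi> ` {x \<in> U. f x \<in> V}) (\<psi> \<circ> f \<circ> inv_into U \<phi>)"
    if "(U, \<phi>) \<in> mcharts M" "(V, \<psi>) \<in> mcharts M'" for U \<phi> V \<psi>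
  proof -
    have U: "chart_via M \<iota> U \<phi>" and V: "chart_via M' \<iota>' V \<psi>"
      using embedded_chart M M' that by blast+
    then have op: "openin (mtop M) U" "openin (mtop M') V"
      unfolding chart_via_def by blast+
    have "openin (mtop M) (U \<inter> {x \<in> points M. f x \<in> V})"
      using op by (intro openin_Int openin_continuous_map_preimage[OF cont])
    moreover have "U \<inter> {x \<in> points M. f x \<in> V} = {x \<in> U. f x \<in> V}"
      using openin_subset[OF op(1)] by auto
    ultimately have op': "openin (top_of_set (Cn (mdim M))) (\<phi> ` {x \<in> U. f x \<in> V})"
      by (intro chart_image_open[OF M U]) auto
    have deriv: "\<exists>D. has_complex_derivative (mdim M) (\<phi> ` {x \<in> U. f x \<in> V})
        (\<psi> \<circ> f \<circ> inv_into U \<phi>) y D" if y: "y \<in> \<phi> ` {x \<in> U. f x \<in> V}" for y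
    proof -
      from y obtain x where x: "x \<in> U" "f x \<in> V" and yx: "y = \<phi> x"
        by blast
      then have "x \<in> points M"
        using openin_subset[OF op(1)] by blast
      show ?thesis
        unfolding yx
        by (rule vhol_in_charts[OF U V, where F = F]) (simp_all add: F x \<open>x \<in> points M\<close>)
    qed
    show ?thesis
      unfolding cholomorphic_def by (intro conjI ballI op' deriv)
  qed
  show ?thesis
    unfolding holomorphic_map_def by (intro conjI ballI cont) (clarify, rule holo)
qed

text \<open>Openness of the chart comes from its inverse formula. Continuity is proved near each
  point, because the ambient formula of a chart exists only locally.\<close>

lemma chart_homeomorphic_map:
  assumes M: "embedded M N \<iota>" and U: "chart_via M \<iota> U \<phi>"
  shows "homeomorphic_map (subtopology (mtop M) U) (top_of_set (\<phi> ` U)) \<phi>"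
proof (rule bijective_open_imp_homeomorphic_map)
  have op: "openin (mtop M) U" and inj: "inj_on \<phi> U"
    using U unfolding chart_via_def by blast+
  have UsM: "U \<subseteq> points M"
    using op openin_subset by blast
  show "\<phi> ` topspace (subtopology (mtop M) U) = topspace (top_of_set (\<phi> ` U))"
    "inj_on \<phi> (topspace (subtopology (mtop M) U))"
    using UsM inj by (auto simp: Int_absorb1)
  show "open_map (subtopology (mtop M) U) (top_of_set (\<phi> ` U)) \<phi>"
    unfolding open_map_def
  proof (intro allI impI)
    fix A assume "openin (subtopology (mtop M) U) A"
    then have A: "openin (mtop M) A" "A \<subseteq> U"
      using op openin_trans_full openin_imp_subset by blast+
    have "\<phi> ` U \<subseteq> Cn (mdim M)"
      using chart_image_open[OF M U op] openin_imp_subset by blast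
    then show "openin (top_of_set (\<phi> ` U)) (\<phi> ` A)"
      using chart_image_open[OF M U A] A(2) by (meson image_mono openin_subset_trans)
  qed
  have "openin (mtop M) {x \<in> U. \<phi> x \<in> O'}" if O': "open O'" for O'
  proof (subst openin_subopen, intro ballI)
    fix x assume x: "x \<in> {x \<in> U. \<phi> x \<in> O'}"
    then have "x \<in> U"
      by simp
    then obtain W F where W: "open W" "\<iota> x \<in> W" and F: "\<And>y. y \<in> W \<Longrightarrow> vhol_at F y"
      "\<And>x'. x' \<in> U \<Longrightarrow> \<iota> x' \<in> W \<Longrightarrow> \<phi> x' = F (\<iota> x')"
      using chart_via_local[OF U] by blast
    have "continuous_on W F"
      using F(1) by (auto intro!: continuous_at_imp_continuous_on vhol_at_isCont)
    then have "open (W \<inter> F -` O')"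
      using W(1) O' by (simp add: continuous_on_open_vimage Int_commute)
    moreover have "continuous_map (mtop M) euclidean \<iota>"
      by (rule embeddedD(2)[OF M])
    ultimately have "openin (mtop M) {x \<in> points M. \<iota> x \<in> W \<inter> F -` O'}"
      using openin_continuous_map_preimage[of "mtop M" euclidean \<iota>] open_openin by blast
    then have "openin (mtop M) (U \<inter> {x \<in> points M. \<iota> x \<in> W \<inter> F -` O'})"
      using op by blast
    moreover have "U \<inter> {x \<in> points M. \<iota> x \<in> W \<inter> F -` O'} \<subseteq> {x \<in> U. \<phi> x \<in> O'}"
      using F(2) by auto
    moreover have "x \<in> U \<inter> {x \<in> points M. \<iota> x \<in> W \<inter> F -` O'}"
      using x W(2) F(2) UsM by auto
    ultimately show "\<exists>T. openin (mtop M) T \<and> x \<in> T \<and> T \<subseteq> {x \<in> U. \<phi> x \<in> O'}"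
      by blast
  qed
  then have "openin (subtopology (mtop M) U) {x \<in> U. \<phi> x \<in> O'}" if "open O'" for O'
    using that op by (simp add: openin_open_subtopology)
  moreover have "topspace (subtopology (mtop M) U) = U"
    using UsM by auto
  ultimately have "continuous_map (subtopology (mtop M) U) euclidean \<phi>"
    unfolding continuous_map_def open_openin[symmetric] by simp
  then show "continuous_map (subtopology (mtop M) U) (top_of_set (\<phi> ` U)) \<phi>"
    by (auto simp: continuous_map_in_subtopology)
qed

text \<open>The transition maps are the chart expressions of the identity, which is holomorphic by
  the ambient criterion; the topological axioms are inherited from \<open>Cn N\<close>.\<close>

lemma complex_manifold_embedded:
  assumes M: "embedded M N \<iota>"
  shows "complex_manifold M"
proof -
  obtain \<kappa> where "homeomorphic_maps (mtop M) (top_of_set (\<iota> ` points M)) \<iota> \<kappa>"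
    using embedded_homeomorphic_maps[OF M] .
  then have homeo: "mtop M homeomorphic_space top_of_set (\<iota> ` points M)"
    unfolding homeomorphic_space_def by blast
  have "top_of_set (\<iota> ` points M) = subtopology (top_of_set (Cn N)) (\<iota> ` points M)"
    by (simp add: subtopology_subtopology Int_absorb1 embeddedD(1)[OF M])
  then have "second_countable (top_of_set (\<iota> ` points M))"
    using second_countable_Cn second_countable_subtopology by metis
  then have sc: "second_countable (mtop M)"
    using homeo homeomorphic_space_second_countability by blast
  have "Hausdorff_space (top_of_set (\<iota> ` points M))"
    by (simp add: Hausdorff_space_subtopology)
  then have hd: "Hausdorff_space (mtop M)"
    using homeo homeomorphic_Hausdorff_space by blast
  have cover: "(\<Union>(U, \<phi>)\<in>mcharts M. U) = points M"
    by (rule embeddedD(3)[OF M])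
  have charts: "chart_via M \<iota> U \<phi>" if "(U, \<phi>) \<in> mcharts M" for U \<phi>
    using embedded_chart[OF M that] .
  have "holomorphic_map M M id"
    by (rule holomorphic_map_embedded[OF M M, where F = "\<lambda>y. y"]) (simp_all add: vhol_at_id)
  then have trans: "cholomorphic (mdim M) (\<phi> ` (U \<inter> V)) (\<psi> \<circ> inv_into U \<phi>)"
    if "(U, \<phi>) \<in> mcharts M" "(V, \<psi>) \<in> mcharts M" for U \<phi> V \<psi>
  proof -
    assume "holomorphic_map M M id"
    then have "\<forall>(U, \<phi>)\<in>mcharts M. \<forall>(V, \<psi>)\<in>mcharts M.
        cholomorphic (mdim M) (\<phi> ` {x \<in> U. id x \<in> V}) (\<psi> \<circ> id \<circ> inv_into U \<phi>)"
      unfolding holomorphic_map_def by (rule conjunct2)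
    from bspec[OF this that(1)] have "\<forall>(V, \<psi>)\<in>mcharts M.
        cholomorphic (mdim M) (\<phi> ` {x \<in> U. id x \<in> V}) (\<psi> \<circ> id \<circ> inv_into U \<phi>)"
      by simp
    from bspec[OF this that(2)] show ?thesis
      by (simp add: Int_def)
  qed
  have ch: "openin (mtop M) U \<and> openin (top_of_set (Cn (mdim M))) (\<phi> ` U)"
    if "(U, \<phi>) \<in> mcharts M" for U \<phi>
    using charts[OF that] by (simp add: chart_via_def)
  show ?thesis
    unfolding complex_manifold_def
    by (intro conjI sc hd cover; clarify)
      (use ch charts chart_homeomorphic_map[OF M] trans in \<open>simp_all\<close>)
qed

lemma chart_viaI:
  assumes "openin (mtop M) U" "inj_on \<phi> U" "openin (top_of_set (Cn (mdim M))) (\<phi> ` U)"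
    and "\<And>x. x \<in> U \<Longrightarrow> \<exists>W F. open W \<and> \<iota> x \<in> W \<and> (\<forall>y\<in>W. vhol_at F y) \<and>
      (\<forall>x'\<in>U. \<iota> x' \<in> W \<longrightarrow> \<phi> x' = F (\<iota> x'))"
    and "\<And>x. x \<in> U \<Longrightarrow> vhol_at G (\<phi> x)" "\<And>x. x \<in> U \<Longrightarrow> G (\<phi> x) = \<iota> x"
  shows "chart_via M \<iota> U \<phi>"
  unfolding chart_via_def by (intro conjI exI[of _ G] ballI assms)

lemma embeddedI:
  assumes "\<iota> ` points M \<subseteq> Cn N" "continuous_map (mtop M) euclidean \<iota>"
    and "continuous_map (top_of_set (\<iota> ` points M)) (mtop M) \<kappa>" "\<And>x. x \<in> points M \<Longrightarrow> \<kappa> (\<iota> x) = x"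
    and "(\<Union>(U, \<phi>)\<in>mcharts M. U) = points M"
    and "\<And>U \<phi>. (U, \<phi>) \<in> mcharts M \<Longrightarrow> chart_via M \<iota> U \<phi>"
  shows "embedded M N \<iota>"
  unfolding embedded_def using assms(6) by (intro conjI exI[of _ \<kappa>] ballI assms) auto

section \<open>Affine space and the punctured line as embedded manifolds\<close>

lemma points_Cn_manifold [simp]: "points (Cn_manifold d) = Cn d"
  and mdim_Cn_manifold [simp]: "mdim (Cn_manifold d) = d"
  by (simp_all add: Cn_manifold_def)

lemma embedded_Cn_manifold: "embedded (Cn_manifold d) d (\<lambda>x. x)"
proof (rule embeddedI[where \<kappa> = "\<lambda>x. x"])
  show "chart_via (Cn_manifold d) (\<lambda>x. x) U \<phi>" if "(U, \<phi>) \<in> mcharts (Cn_manifold d)" for U \<phi>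
  proof (rule chart_viaI[where G = "\<lambda>y. y"])
    show "\<exists>W F. open W \<and> x \<in> W \<and> (\<forall>y\<in>W. vhol_at F y) \<and> (\<forall>x'\<in>U. x' \<in> W \<longrightarrow> \<phi> x' = F x')" for x
      using that by (intro exI[of _ UNIV] exI[of _ "\<lambda>y. y"]) (auto simp: Cn_manifold_def vhol_at_id)
  qed (use that in \<open>auto simp: Cn_manifold_def vhol_at_id\<close>)
qed (auto simp: Cn_manifold_def)

lemma points_Cstar_manifold [simp]: "points Cstar_manifold = - {0}"
  and mdim_Cstar_manifold [simp]: "mdim Cstar_manifold = 1"
  by (simp_all add: Cstar_manifold_def)

lemma embedded_Cstar_manifold: "embedded Cstar_manifold 1 (unit 0)"
proof (rule embeddedI[where \<kappa> = "\<lambda>y. coord y 0"])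
  show "unit 0 ` points Cstar_manifold \<subseteq> Cn 1"
    by (auto intro: unit_in_Cn)
  show "continuous_map (mtop Cstar_manifold) euclidean (unit 0)"
    by (auto simp: Cstar_manifold_def intro: linear_continuous_on bounded_linear_unit)
  show "continuous_map (top_of_set (unit 0 ` points Cstar_manifold)) (mtop Cstar_manifold) (\<lambda>y. coord y 0)"
    by (auto simp: Cstar_manifold_def intro: linear_continuous_on bounded_linear_coord)
  show "chart_via Cstar_manifold (unit 0) U \<phi>" if "(U, \<phi>) \<in> mcharts Cstar_manifold" for U \<phi>
  proof (rule chart_viaI[where G = "\<lambda>y. y"])
    have U: "U = - {0}" "\<phi> = unit 0"
      using that by (auto simp: Cstar_manifold_def)
    show "openin (mtop Cstar_manifold) U"
      unfolding U by (simp add: Cstar_manifold_def)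
    show "inj_on \<phi> U"
      unfolding U by (rule inj_on_subset[OF inj_single]) simp
    have "unit 0 ` (- {0}) = Cn 1 \<inter> (\<lambda>y. coord y 0) -` (- {0})"
    proof (intro equalityI subsetI)
      fix y assume y: "y \<in> Cn 1 \<inter> (\<lambda>y. coord y 0) -` (- {0})"
      then have "y = unit 0 (coord y 0)"
        by (intro poly_mapping_eqI) (auto simp: in_Cn_iff coord_unit)
      then show "y \<in> unit 0 ` (- {0})"
        using y by blast
    qed (auto intro: unit_in_Cn)
    moreover have "open ((\<lambda>y :: cvec. coord y 0) -` (- {0}))"
      by (intro open_vimage linear_continuous_on bounded_linear_coord) auto
    ultimately show "openin (top_of_set (Cn (mdim Cstar_manifold))) (\<phi> ` U)"
      unfolding U by (auto simp: openin_open)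
    show "\<exists>W F. open W \<and> unit 0 x \<in> W \<and> (\<forall>y\<in>W. vhol_at F y) \<and>
        (\<forall>x'\<in>U. unit 0 x' \<in> W \<longrightarrow> \<phi> x' = F (unit 0 x'))" for x
      unfolding U by (intro exI[of _ UNIV] exI[of _ "\<lambda>y. y"]) (simp add: vhol_at_id)
    show "vhol_at (\<lambda>y. y) (\<phi> x)" "\<phi> x = unit 0 x" for x
      unfolding U by (simp_all add: vhol_at_id)
  qed
qed (auto simp: Cstar_manifold_def)

subsection \<open>Products\<close>

text \<open>Agrees with \<open>cat\<close> on \<open>Cn d\<close> and \<open>Cn e\<close>. In
  \<open>cat\<close> the index set of the sum varies with \<open>y\<close>; here it is fixed, so
  differentiability is immediate in every coordinate.\<close>

definition glue :: "nat \<Rightarrow> nat \<Rightarrow> cvec \<Rightarrow> cvec \<Rightarrow> cvec" where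
  "glue d e x y = tuple (d + e) (\<lambda>i. if i < d then coord x i else coord y (i - d))"

lemma cat_eq_glue: "x \<in> Cn d \<Longrightarrow> y \<in> Cn e \<Longrightarrow> cat d x y = glue d e x y"
  by (simp add: cat_eq_tuple glue_def)

lemma vhol_at_glue:
  assumes "vhol_at f x" "vhol_at g x"
  shows "vhol_at (\<lambda>y. glue d e (f y) (g y)) x"
  unfolding glue_def
proof (rule vhol_at_tuple)
  show "shol_at (\<lambda>y. if i < d then coord (f y) i else coord (g y) (i - d)) x" for i
    using assms by (cases "i < d") (auto intro: shol_at_coord_vhol)
qed

lemma continuous_on_vhol: "(\<And>x. x \<in> S \<Longrightarrow> vhol_at f x) \<Longrightarrow> continuous_on S f"
  by (intro continuous_at_imp_continuous_on ballI vhol_at_isCont)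

lemma points_prod_manifold [simp]: "points (prod_manifold M M') = points M \<times> points M'"
  and mdim_prod_manifold [simp]: "mdim (prod_manifold M M') = mdim M + mdim M'"
  by (simp_all add: prod_manifold_def)

abbreviation prod_embedding ::
    "nat \<Rightarrow> ('a \<Rightarrow> cvec) \<Rightarrow> ('b \<Rightarrow> cvec) \<Rightarrow> 'a \<times> 'b \<Rightarrow> cvec" where
  "prod_embedding N \<iota> \<iota>' \<equiv> \<lambda>z. cat N (\<iota> (fst z)) (\<iota>' (snd z))"

lemma chart_range: "chart_via M \<iota> U \<phi> \<Longrightarrow> x \<in> U \<Longrightarrow> \<phi> x \<in> Cn (mdim M)"
  unfolding chart_via_def using openin_imp_subset by blast

lemma chart_domain: "chart_via M \<iota> U \<phi> \<Longrightarrow> x \<in> U \<Longrightarrow> x \<in> points M"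
  unfolding chart_via_def using openin_subset by blast

lemma chart_via_inverse:
  assumes "chart_via M \<iota> U \<phi>"
  obtains G where "\<And>x. x \<in> U \<Longrightarrow> vhol_at G (\<phi> x)" "\<And>x. x \<in> U \<Longrightarrow> G (\<phi> x) = \<iota> x"
proof -
  have "\<exists>G. \<forall>x\<in>U. vhol_at G (\<phi> x) \<and> G (\<phi> x) = \<iota> x"
    using assms unfolding chart_via_def by (elim conjE)
  then obtain G where "\<forall>x\<in>U. vhol_at G (\<phi> x) \<and> G (\<phi> x) = \<iota> x" ..
  then show ?thesis
    by (intro that[of G]) simp_all
qed

lemma open_vimage_vhol: "open W \<Longrightarrow> (\<And>y. vhol_at f y) \<Longrightarrow> open (f -` W)"
  by (intro open_vimage continuous_on_vhol)

text \<open>The formulas of the factors are composed with the two projections of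
  \<open>Cn (N + N')\<close> for the chart, and of the product of the chart domains for its inverse,
  and then glued.\<close>

lemma chart_via_prod:
  assumes M: "embedded M N \<iota>" and M': "embedded M' N' \<iota>'"
    and U: "chart_via M \<iota> U \<phi>" and V: "chart_via M' \<iota>' V \<psi>"
  shows "chart_via (prod_manifold M M') (prod_embedding N \<iota> \<iota>') (U \<times> V)
    (\<lambda>(x, y). cat (mdim M) (\<phi> x) (\<psi> y))"
proof -
  let ?d = "mdim M" and ?e = "mdim M'"
  obtain G where G: "\<And>x. x \<in> U \<Longrightarrow> vhol_at G (\<phi> x)" "\<And>x. x \<in> U \<Longrightarrow> G (\<phi> x) = \<iota> x"
    using chart_via_inverse[OF U] by blast
  obtain H where H: "\<And>x. x \<in> V \<Longrightarrow> vhol_at H (\<psi> x)" "\<And>x. x \<in> V \<Longrightarrow> H (\<psi> x) = \<iota>' x"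
    using chart_via_inverse[OF V] by blast
  note rU = chart_range[OF U] and rV = chart_range[OF V]
  have \<iota>N: "\<iota> x \<in> Cn N" if "x \<in> U" for x
    using embeddedD(1)[OF M] chart_domain[OF U that] by blast
  have \<iota>N': "\<iota>' x \<in> Cn N'" if "x \<in> V" for x
    using embeddedD(1)[OF M'] chart_domain[OF V that] by blast
  have op: "openin (mtop M) U" "openin (top_of_set (Cn ?d)) (\<phi> ` U)" "inj_on \<phi> U"
    "openin (mtop M') V" "openin (top_of_set (Cn ?e)) (\<psi> ` V)" "inj_on \<psi> V"
    using U V by (simp_all add: chart_via_def)
  show ?thesis
  proof (rule chart_viaI[where G = "\<lambda>z. glue N N' (G (tuple ?d (coord z))) (H (rest ?d ?e z))"])
    show "openin (mtop (prod_manifold M M')) (U \<times> V)"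
      using op by (simp add: prod_manifold_def openin_prod_Times_iff)
    show "inj_on (\<lambda>(x, y). cat ?d (\<phi> x) (\<psi> y)) (U \<times> V)"
    proof (intro inj_onI; clarify)
      fix x y x' y'
      assume xy: "x \<in> U" "y \<in> V" "x' \<in> U" "y' \<in> V" and eq: "cat ?d (\<phi> x) (\<psi> y) = cat ?d (\<phi> x') (\<psi> y')"
      have "\<phi> x = \<phi> x'"
        using arg_cong[OF eq, of "\<lambda>z. tuple ?d (coord z)"] xy rU rV by (simp add: tuple_cat)
      moreover have "\<psi> y = \<psi> y'"
        using arg_cong[OF eq, of "rest ?d ?e"] xy rU rV by (simp add: rest_cat)
      ultimately show "x = x' \<and> y = y'"
        using op(3,6) xy by (simp add: inj_on_eq_iff)
    qed
    obtain S T where S: "open S" "\<phi> ` U = Cn ?d \<inter> S" and T: "open T" "\<psi> ` V = Cn ?e \<inter> T"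
      using op(2,5) by (auto simp: openin_open)
    \<comment> \<open>Relative openness is seen by writing the image as the trace of preimages of
      open sets under the two projections.\<close>
    have "(\<lambda>(x, y). cat ?d (\<phi> x) (\<psi> y)) ` (U \<times> V)
        = Cn (?d + ?e) \<inter> ((\<lambda>z. tuple ?d (coord z)) -` S \<inter> rest ?d ?e -` T)" (is "?L = ?R")
    proof (intro equalityI subsetI)
      fix z assume "z \<in> ?L"
      then obtain x y where "x \<in> U" "y \<in> V" "z = cat ?d (\<phi> x) (\<psi> y)"
        by auto
      moreover from this have "\<phi> x \<in> S" "\<psi> y \<in> T"
        using S T by blast+
      ultimately show "z \<in> ?R"
        using rU rV by (simp add: cat_in_Cn tuple_cat rest_cat)
    next
      fix z assume z: "z \<in> ?R"
      then have "tuple ?d (coord z) \<in> \<phi> ` U" "rest ?d ?e z \<in> \<psi> ` V"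
        using S T by simp_all
      then obtain x y where "x \<in> U" "tuple ?d (coord z) = \<phi> x" "y \<in> V" "rest ?d ?e z = \<psi> y"
        by blast
      then have "z = cat ?d (\<phi> x) (\<psi> y)"
        using cat_tuple_rest[of z ?d ?e] z by simp
      then show "z \<in> ?L"
        using \<open>x \<in> U\<close> \<open>y \<in> V\<close> by force
    qed
    moreover have "open ((\<lambda>z. tuple ?d (coord z)) -` S \<inter> rest ?d ?e -` T)"
      using S T by (intro open_Int open_vimage_vhol vhol_at_trunc vhol_at_rest)
    ultimately show "openin (top_of_set (Cn (mdim (prod_manifold M M'))))
        ((\<lambda>(x, y). cat ?d (\<phi> x) (\<psi> y)) ` (U \<times> V))"
      by (auto simp: openin_open)
  next
    fix z assume z: "z \<in> U \<times> V"
    then have z': "fst z \<in> U" "snd z \<in> V"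
      by auto
    obtain W1 F1 where W1: "open W1" "\<iota> (fst z) \<in> W1" and F1: "\<And>y. y \<in> W1 \<Longrightarrow> vhol_at F1 y"
      "\<And>x'. x' \<in> U \<Longrightarrow> \<iota> x' \<in> W1 \<Longrightarrow> \<phi> x' = F1 (\<iota> x')"
      using chart_via_local[OF U z'(1)] by blast
    obtain W2 F2 where W2: "open W2" "\<iota>' (snd z) \<in> W2" and F2: "\<And>y. y \<in> W2 \<Longrightarrow> vhol_at F2 y"
      "\<And>x'. x' \<in> V \<Longrightarrow> \<iota>' x' \<in> W2 \<Longrightarrow> \<psi> x' = F2 (\<iota>' x')"
      using chart_via_local[OF V z'(2)] by blast
    let ?W = "(\<lambda>z. tuple N (coord z)) -` W1 \<inter> rest N N' -` W2"
    let ?F = "\<lambda>y. glue ?d ?e (F1 (tuple N (coord y))) (F2 (rest N N' y))"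
    show "\<exists>W F. open W \<and> prod_embedding N \<iota> \<iota>' z \<in> W \<and> (\<forall>y\<in>W. vhol_at F y) \<and>
        (\<forall>x'\<in>U \<times> V. prod_embedding N \<iota> \<iota>' x' \<in> W \<longrightarrow>
          (case x' of (x, y) \<Rightarrow> cat ?d (\<phi> x) (\<psi> y)) = F (prod_embedding N \<iota> \<iota>' x'))"
    proof (intro exI[of _ ?W] exI[of _ ?F] conjI ballI impI)
      show "open ?W"
        using W1 W2 by (intro open_Int open_vimage_vhol vhol_at_trunc vhol_at_rest)
      show "prod_embedding N \<iota> \<iota>' z \<in> ?W"
        using z W1 W2 \<iota>N \<iota>N' by (auto simp: tuple_cat rest_cat)
      show "vhol_at ?F y" if "y \<in> ?W" for y
        using that F1(1) F2(1)
          vhol_at_compose[of F1 "\<lambda>y. tuple N (coord y)" y] vhol_at_compose[of F2 "rest N N'" y]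
        by (intro vhol_at_glue) (simp_all add: vhol_at_trunc vhol_at_rest)
      show "(case x' of (x, y) \<Rightarrow> cat ?d (\<phi> x) (\<psi> y)) = ?F (prod_embedding N \<iota> \<iota>' x')"
        if x': "x' \<in> U \<times> V" "prod_embedding N \<iota> \<iota>' x' \<in> ?W" for x'
      proof -
        obtain x y where xy: "x' = (x, y)" "x \<in> U" "y \<in> V"
          using x'(1) by (rule SigmaE)
        moreover have "\<iota> x \<in> W1" "\<iota>' y \<in> W2"
          using x'(2) xy \<iota>N \<iota>N' by (simp_all add: tuple_cat rest_cat)
        ultimately show ?thesis
          using \<iota>N \<iota>N' rU[of x] rV[of y] F1(2)[of x] F2(2)[of y]
          by (simp add: tuple_cat rest_cat cat_eq_glue)
      qed
    qed
    obtain x y where xy: "z = (x, y)" "x \<in> U" "y \<in> V"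
      using z by (rule SigmaE)
    show "vhol_at (\<lambda>z. glue N N' (G (tuple ?d (coord z))) (H (rest ?d ?e z)))
        (case z of (x, y) \<Rightarrow> cat ?d (\<phi> x) (\<psi> y))"
      using xy rU rV G(1) H(1)
        vhol_at_compose[of G "\<lambda>z. tuple ?d (coord z)" "cat ?d (\<phi> x) (\<psi> y)"]
        vhol_at_compose[of H "rest ?d ?e" "cat ?d (\<phi> x) (\<psi> y)"]
      by (simp add: vhol_at_glue vhol_at_trunc vhol_at_rest tuple_cat rest_cat)
    show "glue N N' (G (tuple ?d (coord (case z of (x, y) \<Rightarrow> cat ?d (\<phi> x) (\<psi> y)))))
        (H (rest ?d ?e (case z of (x, y) \<Rightarrow> cat ?d (\<phi> x) (\<psi> y)))) = prod_embedding N \<iota> \<iota>' z"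
      using xy rU rV G(2) H(2) \<iota>N \<iota>N' by (simp add: tuple_cat rest_cat cat_eq_glue[of _ N _ N'])
  qed
qed

lemma embedded_prod_manifold:
  assumes M: "embedded M N \<iota>" and M': "embedded M' N' \<iota>'"
  shows "embedded (prod_manifold M M') (N + N') (prod_embedding N \<iota> \<iota>')"
proof -
  obtain \<kappa> where \<kappa>: "homeomorphic_maps (mtop M) (top_of_set (\<iota> ` points M)) \<iota> \<kappa>"
    using embedded_homeomorphic_maps[OF M] .
  obtain \<kappa>' where \<kappa>': "homeomorphic_maps (mtop M') (top_of_set (\<iota>' ` points M')) \<iota>' \<kappa>'"
    using embedded_homeomorphic_maps[OF M'] .
  have \<iota>N: "\<iota> x \<in> Cn N" if "x \<in> points M" for x
    using embeddedD(1)[OF M] that by blast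
  have \<iota>N': "\<iota>' x \<in> Cn N'" if "x \<in> points M'" for x
    using embeddedD(1)[OF M'] that by blast
  let ?P = "prod_manifold M M'" and ?\<iota> = "prod_embedding N \<iota> \<iota>'"
  let ?S = "?\<iota> ` points ?P"
  show ?thesis
  proof (rule embeddedI[where \<kappa> = "\<lambda>z. (\<kappa> (tuple N (coord z)), \<kappa>' (rest N N' z))"])
    show "?\<iota> ` points ?P \<subseteq> Cn (N + N')"
      using \<iota>N \<iota>N' by (auto intro: cat_in_Cn)
    have 1: "continuous_map (mtop ?P) euclidean (\<iota> \<circ> fst)"
      using embeddedD(2)[OF M] unfolding prod_manifold_def
      by (simp add: continuous_map_compose[OF continuous_map_fst])
    \<comment> \<open>On the embedded points \<open>cat N x y\<close> is \<open>x\<close> plus the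
      shifted vector \<open>glue N N' 0 y\<close>, so each factor can be treated separately.\<close>
    have 2: "continuous_map (mtop ?P) euclidean ((\<lambda>y. glue N N' 0 y) \<circ> (\<iota>' \<circ> snd))"
    proof (rule continuous_map_compose)
      show "continuous_map (mtop ?P) euclidean (\<iota>' \<circ> snd)"
        using embeddedD(2)[OF M'] unfolding prod_manifold_def
        by (simp add: continuous_map_compose[OF continuous_map_snd])
      show "continuous_map euclidean euclidean (\<lambda>y. glue N N' 0 y)"
        by (simp add: continuous_on_vhol vhol_at_glue vhol_at_const vhol_at_id)
    qed
    have "continuous_map (mtop ?P) euclidean
        (\<lambda>z. (\<iota> \<circ> fst) z + ((\<lambda>y. glue N N' 0 y) \<circ> (\<iota>' \<circ> snd)) z)"
      by (rule continuous_map_add[OF 1 2])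
    then show "continuous_map (mtop ?P) euclidean ?\<iota>"
    proof (rule continuous_map_eq)
      fix z assume "z \<in> points ?P"
      then have "\<iota> (fst z) \<in> Cn N" "\<iota>' (snd z) \<in> Cn N'"
        using \<iota>N \<iota>N' by auto
      then show "(\<iota> \<circ> fst) z + ((\<lambda>y. glue N N' 0 y) \<circ> (\<iota>' \<circ> snd)) z = ?\<iota> z"
        by (intro poly_mapping_eqI) (auto simp: cat_eq_glue glue_def lookup_add in_Cn_iff)
    qed
    have a: "continuous_map (top_of_set ?S) (mtop M) (\<kappa> \<circ> (\<lambda>z. tuple N (coord z)))"
    proof (rule continuous_map_compose)
      show "continuous_map (top_of_set ?S) (top_of_set (\<iota> ` points M)) (\<lambda>z. tuple N (coord z))"
        using \<iota>N \<iota>N' by (auto simp: tuple_cat intro!: continuous_on_vhol vhol_at_trunc)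
      show "continuous_map (top_of_set (\<iota> ` points M)) (mtop M) \<kappa>"
        using \<kappa> by (simp add: homeomorphic_maps_def)
    qed
    have b: "continuous_map (top_of_set ?S) (mtop M') (\<kappa>' \<circ> rest N N')"
    proof (rule continuous_map_compose)
      show "continuous_map (top_of_set ?S) (top_of_set (\<iota>' ` points M')) (rest N N')"
        using \<iota>N \<iota>N' by (auto simp: rest_cat intro!: continuous_on_vhol vhol_at_rest)
      show "continuous_map (top_of_set (\<iota>' ` points M')) (mtop M') \<kappa>'"
        using \<kappa>' by (simp add: homeomorphic_maps_def)
    qed
    show "continuous_map (top_of_set ?S) (mtop ?P) (\<lambda>z. (\<kappa> (tuple N (coord z)), \<kappa>' (rest N N' z)))"
      using a b by (simp add: prod_manifold_def continuous_map_paired o_def)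
    show "(\<kappa> (tuple N (coord (?\<iota> z))), \<kappa>' (rest N N' (?\<iota> z))) = z" if "z \<in> points ?P" for z
      using that \<iota>N \<iota>N' \<kappa> \<kappa>' by (auto simp: tuple_cat rest_cat homeomorphic_maps_def)
    have "(\<Union>(U, \<phi>)\<in>mcharts ?P. U) = (\<Union>(U, \<phi>)\<in>mcharts M. U) \<times> (\<Union>(U, \<phi>)\<in>mcharts M'. U)"
      by (auto simp: prod_manifold_def) blast
    then show "(\<Union>(U, \<phi>)\<in>mcharts ?P. U) = points ?P"
      by (simp add: embeddedD(3)[OF M] embeddedD(3)[OF M'])
    show "chart_via ?P ?\<iota> U \<phi>" if "(U, \<phi>) \<in> mcharts ?P" for U \<phi>
    proof -
      from that obtain U1 \<phi>1 U2 \<phi>2 where U: "U = U1 \<times> U2" "\<phi> = (\<lambda>(x, y). cat (mdim M) (\<phi>1 x) (\<phi>2 y))"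
        and ch: "(U1, \<phi>1) \<in> mcharts M" "(U2, \<phi>2) \<in> mcharts M'"
        by (auto simp: prod_manifold_def)
      show ?thesis
        unfolding U by (rule chart_via_prod[OF M M' embedded_chart[OF M ch(1)] embedded_chart[OF M' ch(2)]])
    qed
  qed
qed

subsection \<open>Submanifolds of \<open>\<complex>\<^sup>N\<close>\<close>

lemma points_induced_manifold [simp]: "points (induced_manifold N d X) = X"
  and mdim_induced_manifold [simp]: "mdim (induced_manifold N d X) = d"
  by (simp_all add: induced_manifold_def)

lemma tuple_tuple [simp]: "tuple d (coord (tuple d f)) = tuple d f"
  by (simp add: tuple_coord)

text \<open>The extension \<open>F\<close> lives on a relatively open part of \<open>Cn N\<close>,
  the inverse on an open part of \<open>Cn d\<close>; truncating the argument makes both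
  differentiable in the whole space.\<close>

lemma induced_chart_via:
  assumes X: "X \<subseteq> Cn N" and ch: "(U, \<phi>) \<in> mcharts (induced_manifold N d X)"
  shows "chart_via (induced_manifold N d X) (\<lambda>x. x) U \<phi>"
proof -
  from ch have op: "openin (top_of_set X) U" and inj: "inj_on \<phi> U"
    and im: "openin (top_of_set (Cn d)) (\<phi> ` U)" and sub: "cholomorphic_on_subset N U \<phi>"
    and inv: "cholomorphic d (\<phi> ` U) (inv_into U \<phi>)"
    by (auto simp: induced_manifold_def)
  have UN: "U \<subseteq> Cn N"
    using openin_imp_subset[OF op] X by blast
  show ?thesis
  proof (rule chart_viaI[where G = "\<lambda>y. inv_into U \<phi> (tuple d (coord y))"])
    fix x assume x: "x \<in> U"
    show "vhol_at (\<lambda>y. inv_into U \<phi> (tuple d (coord y))) (\<phi> x)"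
      using x by (intro vhol_at_of_cholomorphic[OF inv]) simp
    have "\<phi> x \<in> Cn d"
      using openin_imp_subset[OF im] x by blast
    then show "inv_into U \<phi> (tuple d (coord (\<phi> x))) = x"
      using x inj by (simp add: tuple_coord)
    from sub x obtain W F where W: "x \<in> W" "cholomorphic N W F" "\<forall>y\<in>W \<inter> U. \<phi> y = F y"
      unfolding cholomorphic_on_subset_def by blast
    from W(2) obtain T where T: "open T" "W = Cn N \<inter> T"
      by (auto simp: cholomorphic_def openin_open)
    let ?V = "(\<lambda>y. tuple N (coord y)) -` T"
    show "\<exists>W F. open W \<and> x \<in> W \<and> (\<forall>y\<in>W. vhol_at F y) \<and> (\<forall>x'\<in>U. x' \<in> W \<longrightarrow> \<phi> x' = F x')"
    proof (intro exI[of _ ?V] exI[of _ "\<lambda>y. F (tuple N (coord y))"] conjI ballI impI)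
      show "open ?V"
        using T(1) by (intro open_vimage_vhol vhol_at_trunc)
      show "x \<in> ?V"
        using W(1) T(2) by (simp add: tuple_coord)
      show "vhol_at (\<lambda>y. F (tuple N (coord y))) y" if "y \<in> ?V" for y
      proof -
        have "tuple N (coord y) \<in> W"
          using that T(2) by simp
        from vhol_at_compose[OF vhol_at_of_cholomorphic[OF W(2) this] vhol_at_trunc]
        show ?thesis
          by simp
      qed
      show "\<phi> x' = F (tuple N (coord x'))" if "x' \<in> U" "x' \<in> ?V" for x'
        using that UN T(2) W(3) by (auto simp: tuple_coord subset_iff)
    qed
  qed (use op inj im in \<open>simp_all add: induced_manifold_def\<close>)
qed

text \<open>The atlas already contains every admissible chart and each one is compatible with the
  embedding, so what remains is that some chart exists around each point.\<close>

lemma embedded_induced_manifold: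
  assumes X: "X \<subseteq> Cn N"
    and cover: "\<And>x. x \<in> X \<Longrightarrow> \<exists>U \<phi>. (U, \<phi>) \<in> mcharts (induced_manifold N d X) \<and> x \<in> U"
  shows "embedded (induced_manifold N d X) N (\<lambda>x. x)"
proof (rule embeddedI[where \<kappa> = "\<lambda>x. x"])
  have "U \<subseteq> X" if "(U, \<phi>) \<in> mcharts (induced_manifold N d X)" for U \<phi>
    using that openin_imp_subset by (auto simp: induced_manifold_def)
  then show "(\<Union>(U, \<phi>)\<in>mcharts (induced_manifold N d X). U) = points (induced_manifold N d X)"
    using cover by fastforce
  show "chart_via (induced_manifold N d X) (\<lambda>x. x) U \<phi>"
    if "(U, \<phi>) \<in> mcharts (induced_manifold N d X)" for U \<phi>
    using X that by (rule induced_chart_via)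
qed (use X in \<open>simp_all add: induced_manifold_def\<close>)

text \<open>A chart given by one global formula \<open>\<phi>\<close> with an explicit inverse
  \<open>G\<close>; injectivity and both holomorphy conditions follow from these formulas.\<close>

lemma induced_chartI:
  assumes X: "X \<subseteq> Cn N" and U: "openin (top_of_set X) U"
    and im: "openin (top_of_set (Cn d)) (\<phi> ` U)"
    and \<phi>: "\<And>y. vhol_at \<phi> y"
    and G: "\<And>y. y \<in> \<phi> ` U \<Longrightarrow> vhol_at G y" "\<And>x. x \<in> U \<Longrightarrow> G (\<phi> x) = x"
  shows "(U, \<phi>) \<in> mcharts (induced_manifold N d X)"
proof -
  have inj: "inj_on \<phi> U"
    using G(2) by (rule inj_on_inverseI)
  have "cholomorphic N (Cn N) \<phi>"
    by (rule cholomorphic_of_vhol[of _ _ \<phi>]) (use \<phi> in auto)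
  moreover have "U \<subseteq> Cn N"
    using openin_imp_subset[OF U] X by blast
  ultimately have "cholomorphic_on_subset N U \<phi>"
    unfolding cholomorphic_on_subset_def by blast
  moreover have "cholomorphic d (\<phi> ` U) (inv_into U \<phi>)"
    by (rule cholomorphic_of_vhol[OF im G(1)]) (use inj G(2) in auto)
  ultimately show ?thesis
    using U inj im by (simp add: induced_manifold_def)
qed

subsection \<open>Trivial bundles\<close>

text \<open>Needed because local trivializations are stated over open submanifolds, whereas a
  trivial bundle is trivialized over its whole base by the identity.\<close>

lemma open_submanifold_points:
  assumes "embedded M N \<iota>"
  shows "open_submanifold (M :: 'a cmanifold) (points M) = M"
proof -
  have *: "U \<inter> points M = U" if "(U, \<phi>) \<in> mcharts M" for U \<phi>
    using chart_domain[OF embedded_chart[OF assms that]] by blast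
  have "{(U \<inter> points M, \<phi>) |U \<phi>. (U, \<phi>) \<in> mcharts M} = mcharts M" (is "?C = _")
  proof (intro equalityI subsetI)
    fix c assume "c \<in> ?C"
    then obtain U \<phi> where "c = (U \<inter> points M, \<phi>)" "(U, \<phi>) \<in> mcharts M"
      by blast
    then show "c \<in> mcharts M"
      by (simp add: *)
  next
    fix c assume c: "c \<in> mcharts M"
    obtain U \<phi> where "c = (U, \<phi>)"
      by (cases c)
    then have "c = (U \<inter> points M, \<phi>)" "(U, \<phi>) \<in> mcharts M"
      using c * by simp_all
    then show "c \<in> ?C"
      by blast
  qed
  then show ?thesis
    by (simp add: open_submanifold_def)
qed

definition trivial_bundle :: "'a cmanifold \<Rightarrow> nat \<Rightarrow> ('a \<times> cvec, 'a) vbundle" where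
  "trivial_bundle X r =
     \<lparr>total = prod_manifold X (Cn_manifold r), proj = fst, brank = r,
      badd = \<lambda>e f. (fst e, snd e + snd f), bscale = \<lambda>c e. (fst e, cscale c (snd e)),
      bzero = \<lambda>x. (x, 0)\<rparr>"

lemma trivial_bundle_simps [simp]:
  "total (trivial_bundle X r) = prod_manifold X (Cn_manifold r)"
  "proj (trivial_bundle X r) = fst" "brank (trivial_bundle X r) = r"
  "badd (trivial_bundle X r) e f = (fst e, snd e + snd f)"
  "bscale (trivial_bundle X r) c e = (fst e, cscale c (snd e))"
  "bzero (trivial_bundle X r) x = (x, 0)"
  by (simp_all add: trivial_bundle_def)

lemma embedded_trivial_bundle:
  assumes "embedded X N \<iota>"
  shows "embedded (prod_manifold X (Cn_manifold r)) (N + r) (\<lambda>z. cat N (\<iota> (fst z)) (snd z))"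
  using embedded_prod_manifold[OF assms embedded_Cn_manifold] .

lemma holomorphic_vector_bundle_trivial:
  fixes X :: "'a cmanifold"
  assumes X: "embedded X N \<iota>"
  shows "holomorphic_vector_bundle X (trivial_bundle X r)"
proof -
  let ?B = "trivial_bundle X r" and ?E = "prod_manifold X (Cn_manifold r)"
  note E = embedded_trivial_bundle[OF X, of r]
  have \<iota>N: "\<iota> x \<in> Cn N" if "x \<in> points X" for x
    using embeddedD(1)[OF X] that by blast
  have proj: "holomorphic_map ?E X fst"
    by (rule holomorphic_map_embedded[OF E X, where F = "\<lambda>z. tuple N (coord z)"])
      (auto simp: vhol_at_trunc tuple_cat \<iota>N)
  have id: "holomorphic_map ?E ?E id"
    by (rule holomorphic_map_embedded[OF E E, where F = "\<lambda>z. z"]) (simp_all add: vhol_at_id)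
  have over: "over ?B (points X) = points ?E"
    by (auto simp: over_def)
  have "biholomorphic_map ?E ?E id"
    unfolding biholomorphic_map_def using id by (intro conjI exI[of _ id]) simp_all
  then have "local_trivialization X ?B (points X) id"
    unfolding local_trivialization_def over
    by (simp add: open_submanifold_points[OF X]
        open_submanifold_points[OF E, simplified])
  then have "\<exists>U \<Phi>. x \<in> U \<and> local_trivialization X ?B U \<Phi>" if "x \<in> points X" for x
    using that by blast
  then show ?thesis
    unfolding holomorphic_vector_bundle_def
    using complex_manifold_embedded[OF X] complex_manifold_embedded[OF E] proj
    by (auto simp: over_def add_in_Cn cscale_in_Cn)
qed

section \<open>The complex Lie group of nonzero complex numbers\<close>

lemma group_Cstar: "group Cstar"
proof (rule groupI)
  show "\<exists>y\<in>carrier Cstar. y \<otimes>\<^bsub>Cstar\<^esub> x = \<one>\<^bsub>Cstar\<^esub>" if "x \<in> carrier Cstar" for x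
    using that by (intro bexI[of _ "inverse x"]) (auto simp: Cstar_def)
qed (auto simp: Cstar_def)

lemma complex_lie_group_Cstar: "complex_lie_group Cstar Cstar_manifold"
proof -
  note T = embedded_Cstar_manifold
  note TT = embedded_prod_manifold[OF T T]
  have "holomorphic_map (prod_manifold Cstar_manifold Cstar_manifold) Cstar_manifold
      (\<lambda>(g, h). g \<otimes>\<^bsub>Cstar\<^esub> h)"
  proof (rule holomorphic_map_embedded[OF TT T, where F = "\<lambda>z. unit 0 (coord z 0 * coord z 1)"])
    show "vhol_at (\<lambda>z. unit 0 (coord z 0 * coord z 1)) z" for z
      by (intro vhol_at_unit shol_at_mult shol_at_coord)
  qed (auto simp: Cstar_def coord_cat coord_unit)
  moreover have "holomorphic_map Cstar_manifold Cstar_manifold (\<lambda>g. inv\<^bsub>Cstar\<^esub> g)"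
  proof (rule holomorphic_map_embedded[OF T T, where F = "\<lambda>z. unit 0 (1 / coord z 0)"])
    have inv: "inv\<^bsub>Cstar\<^esub> g = 1 / g" if "g \<noteq> 0" for g
      using that by (intro group.inv_equality[OF group_Cstar]) (auto simp: Cstar_def)
    show "vhol_at (\<lambda>z. unit 0 (1 / coord z 0)) (unit 0 x)" if "x \<in> points Cstar_manifold" for x
      using that by (intro vhol_at_unit shol_at_divide shol_at_const shol_at_coord) simp
    show "unit 0 (inv\<^bsub>Cstar\<^esub> x) = unit 0 (1 / coord (unit 0 x) 0)"
      "inv\<^bsub>Cstar\<^esub> x \<in> points Cstar_manifold" if "x \<in> points Cstar_manifold" for x
      using that by (simp_all add: inv)
  qed
  ultimately show ?thesis
    unfolding complex_lie_group_def using group_Cstar complex_manifold_embedded[OF T]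
    by (simp add: Cstar_def)
qed

subsection \<open>Separately affine hypersurfaces\<close>

text \<open>The integral of exp (t z) over 0 \<le> t \<le> 1, an entire function. For constant
  \<open>c\<close>, \<open>s * expq (s * c)\<close> is the solution of y' = 1 + c y with y(0) = 0;
  the value 1 at 0 covers the case c = 0.\<close>

definition expq :: "complex \<Rightarrow> complex" where
  "expq z = (if z = 0 then 1 else (exp z - 1) / z)"

text \<open>It is the difference quotient of exp at 0, completed by the derivative of exp there: a
  removable singularity.\<close>

lemma expq_field_differentiable: "expq field_differentiable at z"
proof -
  have "(\<lambda>z. if z = 0 then deriv exp 0 else (exp z - exp 0) / (z - 0)) holomorphic_on (UNIV :: complex set)"
    by (intro pole_lemma_open holomorphic_intros) auto
  moreover have "(\<lambda>z. if z = 0 then deriv exp 0 else (exp z - exp 0) / (z - 0)) = expq"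
    using DERIV_imp_deriv[OF DERIV_exp[of "0 :: complex"]] by (simp add: expq_def fun_eq_iff)
  ultimately have "expq holomorphic_on UNIV"
    by simp
  then show ?thesis
    by (rule holomorphic_on_imp_differentiable_at) auto
qed

text \<open>A form of exp y * exp (- y) = 1. It is exactly the cancellation that makes the flows
  below preserve \<open>q\<close>.\<close>

lemma expq_minus: "expq y - expq (- y) = y * expq y * expq (- y)"
proof (cases "y = 0")
  case False
  have "exp y * exp (- y) = 1"
    by (simp add: exp_minus)
  with False show ?thesis
    by (simp add: expq_def field_simps)
qed (simp add: expq_def)

lemma has_cderiv_linear:
  "has_cderiv (\<lambda>w. tuple r (\<lambda>j. \<Sum>i<m. coord w i * a i j)) (\<lambda>w. tuple r (\<lambda>j. \<Sum>i<m. coord w i * a i j)) x"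
  unfolding tuple_def
proof (intro has_cderiv_sum has_cderiv_unit bounded_linear_imp_has_derivative bounded_linear_sum)
  show "bounded_linear (\<lambda>w. coord w i * a i j)" for i j
    by (rule bounded_linear_compose[OF bounded_linear_mult_left bounded_linear_coord])
qed (simp add: sum_distrib_left mult.assoc)

text \<open>The factor \<open>coord w j\<close> vanishes at 0, so the derivative of \<open>f\<close>
  drops out of the product rule and need not be computed.\<close>

lemma has_derivative_coord_mult:
  assumes "shol_at f 0"
  shows "((\<lambda>w. coord w j * f w) has_derivative (\<lambda>h. coord h j * f 0)) (at 0)"
proof -
  obtain D where "(f has_derivative D) (at 0)"
    using assms shol_at_def by blast
  from has_derivative_mult[OF bounded_linear_imp_has_derivative[OF bounded_linear_coord[of j]] this]
  show ?thesis
    by simp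
qed

text \<open>All that the geometric argument uses of q = uv - p. The coordinates are 0, ...,
  \<open>d\<close>, so the hypersurface has dimension \<open>d\<close>. Degree at most one is
  expressed by interpolation between two values, which yields partial derivatives without any
  calculus.\<close>

locale affine_hypersurface =
  fixes d :: nat and q :: "cvec \<Rightarrow> complex" and \<omega> :: "nat \<Rightarrow> int"
  assumes hol: "shol_at q z"
    and affine: "k \<le> d \<Longrightarrow> q (z + unit k s) = q z + s * (q (z + unit k 1) - q z)"
    and smooth: "z \<in> Cn (Suc d) \<Longrightarrow> q z = 0 \<Longrightarrow> \<exists>k\<le>d. q (z + unit k 1) \<noteq> q z"
    and invariant: "t \<noteq> 0 \<Longrightarrow> z \<in> Cn (Suc d) \<Longrightarrow> q (tuple (Suc d) (\<lambda>i. t powi \<omega> i * coord z i)) = q z"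
begin

text \<open>As \<open>q\<close> is affine in each variable, its partial derivatives are difference quotients.\<close>

definition pd :: "nat \<Rightarrow> cvec \<Rightarrow> complex" where
  "pd k z = q (z + unit k 1) - q z"

definition pd2 :: "nat \<Rightarrow> nat \<Rightarrow> cvec \<Rightarrow> complex" where
  "pd2 k l z = pd k (z + unit l 1) - pd k z"

definition X :: "cvec set" where
  "X = {z \<in> Cn (Suc d). q z = 0}"

definition act :: "complex \<Rightarrow> cvec \<Rightarrow> cvec" where
  "act t z = tuple (Suc d) (\<lambda>i. t powi \<omega> i * coord z i)"

lemma q_add: "k \<le> d \<Longrightarrow> q (z + unit k s) = q z + s * pd k z"
  by (simp add: pd_def affine[symmetric])

lemma pd_add:
  assumes "l \<le> d"
  shows "pd k (z + unit l s) = pd k z + s * pd2 k l z"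
proof -
  have *: "q (z + unit l s' + unit k 1) = q (z + unit k 1) + s' * pd l (z + unit k 1)" for s'
    using q_add[OF assms, of "z + unit k 1" s'] by (simp add: add_ac)
  show ?thesis
    unfolding pd2_def pd_def[of k] * q_add[OF assms] by (simp add: algebra_simps)
qed

text \<open>A second difference in one direction, found by comparing the steps 1 and 2; it vanishes
  for an affine function.\<close>

lemma pd2_self: "k \<le> d \<Longrightarrow> pd2 k k z = 0"
  using q_add[of k z 2] q_add[of k z 1]
  by (simp add: pd2_def pd_def[of k "z + unit k 1"] add.assoc single_add[symmetric])

lemma pd_self: "k \<le> d \<Longrightarrow> pd k (z + unit k s) = pd k z"
  by (simp add: pd_add pd2_self)

lemma vhol_at_add_unit: "vhol_at (\<lambda>z. z + unit k a) z"
  by (intro vhol_at_add vhol_at_id vhol_at_const)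

lemma shol_at_pd: "shol_at (pd k) z"
  unfolding pd_def[abs_def]
  by (rule shol_at_diff[OF shol_at_compose[OF hol vhol_at_add_unit] hol])

lemma shol_at_pd2: "shol_at (pd2 k l) z"
  unfolding pd2_def[abs_def]
  by (rule shol_at_diff[OF shol_at_compose[OF shol_at_pd vhol_at_add_unit] shol_at_pd])

text \<open>Links the difference quotients to the differential: along a coordinate line
  \<open>q\<close> is affine, so its derivative there is its slope \<open>pd k z\<close>, and
  complex linearity does the rest.\<close>

lemma q_derivative:
  assumes "(q has_derivative D) (at z)" "\<And>c h. D (cscale c h) = c * D h" "h \<in> Cn (Suc d)"
  shows "D h = (\<Sum>k\<le>d. coord h k * pd k z)"
proof -
  have unit: "D (unit k 1) = pd k z" if "k \<le> d" for k
  proof -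
    have "(\<lambda>t::real. q (z + t *\<^sub>R unit k 1)) = (\<lambda>t. q z + of_real t * pd k z)"
    proof
      fix t :: real
      have "t *\<^sub>R unit k 1 = unit k (of_real t)"
        by (rule poly_mapping_eqI) (simp add: scaleR_eq_cscale coord_unit)
      then show "q (z + t *\<^sub>R unit k 1) = q z + of_real t * pd k z"
        by (simp add: q_add that)
    qed
    then have "((\<lambda>t::real. q z + of_real t * pd k z) has_derivative (\<lambda>t. D (t *\<^sub>R unit k 1))) (at 0)"
      using has_derivative_line[OF assms(1), of "unit k 1"] by simp
    moreover have "((\<lambda>t::real. q z + of_real t * pd k z) has_derivative (\<lambda>t. of_real t * pd k z)) (at 0)"
      by (auto intro!: derivative_eq_intros)
    ultimately have "(\<lambda>t. D (t *\<^sub>R unit k 1)) = (\<lambda>t. of_real t * pd k z)"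
      by (rule has_derivative_unique)
    from fun_cong[OF this, of 1] show ?thesis
      by simp
  qed
  have lin: "linear D"
    using assms(1) has_derivative_linear by blast
  have "h = (\<Sum>k<Suc d. cscale (coord h k) (unit k 1))"
    using assms(3) by (intro poly_mapping_eqI) (auto simp: lookup_sum coord_unit in_Cn_iff if_distrib simp del: sum.lessThan_Suc cong: if_cong)
  then have "D h = D (\<Sum>k<Suc d. cscale (coord h k) (unit k 1))"
    by simp
  also have "\<dots> = (\<Sum>k<Suc d. coord h k * D (unit k 1))"
    by (simp only: linear_sum[OF lin] assms(2))
  finally show ?thesis
    by (simp add: unit lessThan_Suc_atMost)
qed

section \<open>Charts obtained by solving for one coordinate\<close>

definition del :: "nat \<Rightarrow> cvec \<Rightarrow> cvec" where
  "del m z = tuple d (\<lambda>i. if i < m then coord z i else coord z (Suc i))"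

text \<open>The inserted 0 is a placeholder to which the solved value is added later; coordinates
  behind it move up by one, hence the index \<open>i - 1\<close>.\<close>

definition ins :: "nat \<Rightarrow> cvec \<Rightarrow> cvec" where
  "ins m y = tuple (Suc d) (\<lambda>i. if i < m then coord y i else if i = m then 0 else coord y (i - 1))"

lemma ins_in_Cn [simp]: "ins m y \<in> Cn (Suc d)"
  by (simp add: ins_def)

lemma ins_del: "z \<in> Cn (Suc d) \<Longrightarrow> m \<le> d \<Longrightarrow> ins m (del m z) + unit m (coord z m) = z"
  by (rule poly_mapping_eqI) (auto simp: ins_def del_def lookup_add coord_unit in_Cn_iff)

lemma del_ins: "y \<in> Cn d \<Longrightarrow> m \<le> d \<Longrightarrow> del m (ins m y + unit m s) = y"
  by (rule poly_mapping_eqI) (auto simp: ins_def del_def lookup_add coord_unit in_Cn_iff)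

lemma vhol_at_del: "vhol_at (del m) z"
  unfolding del_def[abs_def]
proof (rule vhol_at_tuple)
  show "shol_at (\<lambda>z. if i < m then coord z i else coord z (Suc i)) z" for i
    by (cases "i < m") (simp_all add: shol_at_coord)
qed

lemma vhol_at_ins: "vhol_at (ins m) y"
  unfolding ins_def[abs_def]
proof (rule vhol_at_tuple)
  show "shol_at (\<lambda>y. if i < m then coord y i else if i = m then 0 else coord y (i - 1)) y" for i
    by (cases "i < m"; cases "i = m") (simp_all add: shol_at_coord shol_at_const)
qed

abbreviation "M \<equiv> induced_manifold (Suc d) d X"

text \<open>In the coordinate \<open>m\<close>, \<open>q\<close> is affine with slope
  \<open>pd m\<close>, and this slope does not depend on that coordinate. So q = 0 is one linear
  equation with the solution occurring in \<open>G\<close>, and the condition that the slope is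
  nonzero depends on the remaining coordinates only.\<close>

lemma chart_del:
  assumes m: "m \<le> d"
  shows "({z \<in> X. pd m z \<noteq> 0}, del m) \<in> mcharts M"
proof (rule induced_chartI[where G = "\<lambda>y. ins m y + unit m (- q (ins m y) / pd m (ins m y))"])
  let ?U = "{z \<in> X. pd m z \<noteq> 0}" and ?G = "\<lambda>y. ins m y + unit m (- q (ins m y) / pd m (ins m y))"
  have open_nz: "open {z. f z \<noteq> 0}" if "\<And>z. shol_at f z" for f :: "cvec \<Rightarrow> complex"
  proof -
    have "continuous_on UNIV f"
      using that by (intro continuous_at_imp_continuous_on ballI shol_at_isCont)
    then have "open (f -` (- {0}))"
      by (intro open_vimage) auto
    then show ?thesis
      by (simp add: vimage_def)
  qed
  show "X \<subseteq> Cn (Suc d)"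
    by (auto simp: X_def)
  have "?U = X \<inter> {z. pd m z \<noteq> 0}"
    by auto
  then show "openin (top_of_set X) ?U"
    using openin_open_Int[OF open_nz[of "pd m", OF shol_at_pd], of X] by simp
  show "vhol_at (del m) y" for y
    by (rule vhol_at_del)
  have pd_ins: "pd m (ins m (del m z)) = pd m z" if "z \<in> Cn (Suc d)" for z
    using pd_self[OF m, of "ins m (del m z)" "coord z m"] ins_del[OF that m] by simp
  have im: "del m ` ?U = Cn d \<inter> {y. pd m (ins m y) \<noteq> 0}"
  proof (intro equalityI subsetI)
    fix y assume "y \<in> del m ` ?U"
    then show "y \<in> Cn d \<inter> {y. pd m (ins m y) \<noteq> 0}"
      by (auto simp: X_def pd_ins) (simp add: del_def)
  next
    fix y assume y: "y \<in> Cn d \<inter> {y. pd m (ins m y) \<noteq> 0}"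
    then have "y = del m (?G y)"
      by (simp add: del_ins m)
    moreover have "?G y \<in> ?U"
      using y m by (auto simp: X_def q_add pd_self less_Suc_eq_le intro!: add_in_Cn unit_in_Cn)
    ultimately show "y \<in> del m ` ?U"
      by blast
  qed
  have sh_q: "shol_at (\<lambda>y. q (ins m y)) y" and sh_pd: "shol_at (\<lambda>y. pd m (ins m y)) y" for y
    by (rule shol_at_compose[OF hol vhol_at_ins], rule shol_at_compose[OF shol_at_pd vhol_at_ins])
  show "openin (top_of_set (Cn d)) (del m ` ?U)"
    unfolding im using open_nz[OF sh_pd] by (rule openin_open_Int)
  show "vhol_at ?G y" if "y \<in> del m ` ?U" for y
    using that im
    by (intro vhol_at_add vhol_at_ins vhol_at_unit shol_at_divide shol_at_uminus sh_q sh_pd) auto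
  show "?G (del m z) = z" if "z \<in> ?U" for z
  proof -
    from that have z: "z \<in> Cn (Suc d)" "q z = 0" "pd m z \<noteq> 0"
      by (auto simp: X_def)
    have "q (ins m (del m z)) + coord z m * pd m z = 0"
      using q_add[OF m, of "ins m (del m z)" "coord z m"] ins_del[OF z(1) m] z(2) pd_ins[OF z(1)] by simp
    then have "- q (ins m (del m z)) / pd m (ins m (del m z)) = coord z m"
      using z(3) pd_ins[OF z(1)] by (simp add: field_simps add_eq_0_iff)
    then show ?thesis
      using ins_del[OF z(1) m] by simp
  qed
qed

lemma embedded_M: "embedded M (Suc d) (\<lambda>x. x)"
proof (rule embedded_induced_manifold)
  show "X \<subseteq> Cn (Suc d)"
    by (auto simp: X_def)
  fix x assume x: "x \<in> X"
  then obtain m where "m \<le> d" "pd m x \<noteq> 0"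
    using smooth[of x] by (auto simp: X_def pd_def)
  then show "\<exists>U \<phi>. (U, \<phi>) \<in> mcharts M \<and> x \<in> U"
    using chart_del x by blast
qed

subsection \<open>The flows\<close>

text \<open>The flow of the vector field \<open>pd k \<partial>\<^sub>l - pd l \<partial>\<^sub>k\<close>, which is tangent to the level sets of \<open>q\<close>. It is
  complete: along it \<open>pd2 k l\<close> is constant, and \<open>pd k\<close> and \<open>pd l\<close> solve linear equations with this
  coefficient.\<close>

definition flow :: "nat \<Rightarrow> nat \<Rightarrow> complex \<Rightarrow> cvec \<Rightarrow> cvec" where
  "flow k l s z = z + unit k (s * (- pd l z * expq (- (s * pd2 k l z))))
                    + unit l (s * (pd k z * expq (s * pd2 k l z)))"

lemma pd2_sym: "pd2 k l z = pd2 l k z"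
  by (simp add: pd2_def pd_def add_ac)

text \<open>\<open>q\<close> is affine in each of the two moved coordinates, so its increment is a
  polynomial in the two displacements that vanishes by \<open>expq_minus\<close>.\<close>

lemma q_flow:
  assumes "k \<le> d" "l \<le> d"
  shows "q (flow k l s z) = q z"
proof (cases "k = l")
  case True
  then show ?thesis
    using assms by (simp add: flow_def pd2_self expq_def add.assoc single_add[symmetric])
next
  case False
  define y where "y = s * pd2 k l z"
  \<comment> \<open>An exact expansion: there are no terms beyond the mixed one.\<close>
  have *: "q (z + unit k \<alpha> + unit l \<beta>) = q z + \<alpha> * pd k z + \<beta> * (pd l z + \<alpha> * pd2 k l z)" for \<alpha> \<beta>
    by (simp add: q_add pd_add assms pd2_sym[of k l])
  have "q (flow k l s z) = q z + s * pd k z * pd l z * (expq y - expq (- y) - y * expq y * expq (- y))"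
    unfolding flow_def * y_def by (simp add: algebra_simps)
  then show ?thesis
    by (simp add: expq_minus)
qed

lemma flow_in_Cn: "z \<in> Cn (Suc d) \<Longrightarrow> k \<le> d \<Longrightarrow> l \<le> d \<Longrightarrow> flow k l s z \<in> Cn (Suc d)"
  unfolding flow_def by (intro add_in_Cn unit_in_Cn) auto

lemma flow_0 [simp]: "flow k l 0 z = z"
  by (simp add: flow_def)

lemma vhol_at_flow:
  assumes "shol_at f y" "vhol_at A y"
  shows "vhol_at (\<lambda>y. flow k l (f y) (A y)) y"
proof -
  have pd: "shol_at (\<lambda>y. pd k (A y)) y" for k
    by (rule shol_at_compose[OF shol_at_pd assms(2)])
  have pd2: "shol_at (\<lambda>y. pd2 k l (A y)) y"
    by (rule shol_at_compose[OF shol_at_pd2 assms(2)])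
  have expq: "shol_at (\<lambda>y. expq (g y)) y" if "shol_at g y" for g
    by (rule shol_at_field[OF that expq_field_differentiable])
  show ?thesis
    unfolding flow_def
    by (intro vhol_at_add vhol_at_unit shol_at_mult shol_at_uminus expq pd pd2 assms)
qed

section \<open>Behaviour of the flows under the torus\<close>

lemma act_add_unit: "k \<le> d \<Longrightarrow> act t (z + unit k s) = act t z + unit k (t powi \<omega> k * s)"
  by (rule poly_mapping_eqI) (auto simp: act_def lookup_add coord_unit algebra_simps)

lemma act_in_Cn [simp]: "act t z \<in> Cn (Suc d)"
  by (simp add: act_def)

lemma q_act: "t \<noteq> 0 \<Longrightarrow> z \<in> Cn (Suc d) \<Longrightarrow> q (act t z) = q z"
  using invariant by (simp add: act_def)

text \<open>A unit step at \<open>act t z\<close> is the image of a step of length t^(- \<omega> k)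
  at \<open>z\<close>, and \<open>q\<close> is invariant.\<close>

lemma pd_act:
  assumes "t \<noteq> 0" "z \<in> Cn (Suc d)" "k \<le> d"
  shows "pd k (act t z) = inverse (t powi \<omega> k) * pd k z"
proof -
  have "act t z + unit k 1 = act t (z + unit k (inverse (t powi \<omega> k)))"
    using assms by (simp add: act_add_unit)
  then show ?thesis
    using assms by (simp add: pd_def[of k "act t z"] q_act q_add add_in_Cn unit_in_Cn)
qed

lemma pd2_act:
  assumes "t \<noteq> 0" "z \<in> Cn (Suc d)" "k \<le> d" "l \<le> d"
  shows "pd2 k l (act t z) = inverse (t powi \<omega> k) * inverse (t powi \<omega> l) * pd2 k l z"
proof -
  have "act t z + unit l 1 = act t (z + unit l (inverse (t powi \<omega> l)))"
    using assms by (simp add: act_add_unit)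
  then show ?thesis
    using assms by (simp add: pd2_def[of k l "act t z"] pd_act pd_add add_in_Cn unit_in_Cn algebra_simps)
qed

text \<open>The weight of the time cancels that of \<open>pd2 k l\<close>, so the arguments of
  \<open>expq\<close> are unchanged. In each displacement it cancels against the weight of the
  partial derivative and leaves the weight of the coordinate that moves.\<close>

lemma flow_act:
  assumes "t \<noteq> 0" "z \<in> Cn (Suc d)" "k \<le> d" "l \<le> d"
  shows "flow k l (t powi (\<omega> k + \<omega> l) * s) (act t z) = act t (flow k l s z)"
proof -
  define a b where "a = t powi \<omega> k" and "b = t powi \<omega> l"
  have ab: "a \<noteq> 0" "b \<noteq> 0" "t powi (\<omega> k + \<omega> l) = a * b"
    using assms(1) by (simp_all add: a_def b_def power_int_add)
  have e: "a * b * s * (inverse a * inverse b * pd2 k l z) = s * pd2 k l z"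
    using ab by (simp add: field_simps)
  have "flow k l (a * b * s) (act t z) =
      act t z + unit k (a * b * s * (- (inverse b * pd l z) * expq (- (s * pd2 k l z))))
              + unit l (a * b * s * (inverse a * pd k z * expq (s * pd2 k l z)))"
    by (simp only: flow_def pd_act pd2_act assms not_False_eq_True a_def[symmetric] b_def[symmetric] e)
  also have "\<dots> = act t z + unit k (a * (s * (- pd l z * expq (- (s * pd2 k l z)))))
              + unit l (b * (s * (pd k z * expq (s * pd2 k l z))))"
    using ab by (simp add: field_simps)
  also have "\<dots> = act t (flow k l s z)"
    by (simp only: flow_def act_add_unit assms a_def b_def)
  finally show ?thesis
    by (simp only: ab)
qed

end

subsection \<open>The spray\<close>

context affine_hypersurface
begin

text \<open>One fibre coordinate for every ordered pair, diagonal pairs included; the pair (k, l)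
  has index k (d + 1) + l and is recovered by \<open>div\<close> and \<open>mod\<close>. The
  redundancy is harmless, as the fields only have to span.\<close>

definition r :: nat where
  "r = Suc d * Suc d"

primrec flows :: "nat \<Rightarrow> cvec \<Rightarrow> cvec \<Rightarrow> cvec" where
  "flows 0 z w = z"
| "flows (Suc j) z w = flow (j div Suc d) (j mod Suc d) (coord w j) (flows j z w)"

text \<open>The weights do not depend on the base point, so a diagonal linear action on the fibre
  coordinates lifts the action to the product.\<close>

definition act_bundle :: "complex \<Rightarrow> cvec \<Rightarrow> cvec" where
  "act_bundle t w = tuple r (\<lambda>j. t powi (\<omega> (j div Suc d) + \<omega> (j mod Suc d)) * coord w j)"

lemma index_le:
  assumes "j < r"
  shows "j div Suc d \<le> d" "j mod Suc d \<le> d"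
proof -
  show "j div Suc d \<le> d"
    using less_mult_imp_div_less[OF assms[unfolded r_def]] by simp
  show "j mod Suc d \<le> d"
    using mod_less_divisor[of "Suc d" j] by linarith
qed

lemma flows_in_Cn: "j \<le> r \<Longrightarrow> z \<in> Cn (Suc d) \<Longrightarrow> flows j z w \<in> Cn (Suc d)"
proof (induction j)
  case (Suc j)
  then show ?case
    using index_le[of j] by (simp add: flow_in_Cn)
qed simp

lemma q_flows: "j \<le> r \<Longrightarrow> q (flows j z w) = q z"
proof (induction j)
  case (Suc j)
  then show ?case
    using index_le[of j] by (simp add: q_flow)
qed simp

lemma flows_in_X: "z \<in> X \<Longrightarrow> flows r z w \<in> X"
  using flows_in_Cn[of r z w] q_flows[of r z w] by (simp add: X_def)

lemma flows_zero [simp]: "flows j z 0 = z"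
  by (induction j) simp_all

lemma vhol_at_flows:
  assumes "vhol_at A y" "vhol_at B y"
  shows "vhol_at (\<lambda>y. flows j (A y) (B y)) y"
proof (induction j)
  case (Suc j)
  show ?case
    unfolding flows.simps by (rule vhol_at_flow[OF shol_at_coord_vhol[OF assms(2)] Suc])
qed (simp add: assms)

lemma act_in_X: "t \<noteq> 0 \<Longrightarrow> z \<in> X \<Longrightarrow> act t z \<in> X"
  by (simp add: X_def q_act)

lemma flows_act:
  assumes "t \<noteq> 0" "z \<in> Cn (Suc d)"
  shows "j \<le> r \<Longrightarrow> flows j (act t z) (act_bundle t w) = act t (flows j z w)"
proof (induction j)
  case (Suc j)
  then have "coord (act_bundle t w) j = t powi (\<omega> (j div Suc d) + \<omega> (j mod Suc d)) * coord w j"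
    by (simp add: act_bundle_def)
  then show ?case
    using Suc index_le[of j] flows_in_Cn[of j z w] assms by (simp add: flow_act)
qed simp

definition flows_deriv :: "cvec \<Rightarrow> nat \<Rightarrow> cvec \<Rightarrow> cvec" where
  "flows_deriv z j h = (\<Sum>i<j. unit (i div Suc d) (coord h i * - pd (i mod Suc d) z)
     + unit (i mod Suc d) (coord h i * pd (i div Suc d) z))"

text \<open>At w = 0 every earlier flow is the identity, so each new factor adds its own vector
  field evaluated at the original point \<open>z\<close>.\<close>

lemma has_cderiv_flows: "has_cderiv (flows j z) (flows_deriv z j) 0"
proof (induction j)
  case 0
  then show ?case
    by (simp add: flows_deriv_def has_cderiv_const)
next
  case (Suc j)
  let ?A = "flows j z" and ?k = "j div Suc d" and ?l = "j mod Suc d"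
  have A: "vhol_at ?A 0"
    by (rule vhol_at_flows[OF vhol_at_const vhol_at_id])
  have pd: "shol_at (\<lambda>y. pd k (?A y)) 0" for k
    by (rule shol_at_compose[OF shol_at_pd A])
  have pd2: "shol_at (\<lambda>y. coord y j * pd2 ?k ?l (?A y)) 0"
    by (rule shol_at_mult[OF shol_at_coord shol_at_compose[OF shol_at_pd2 A]])
  have expq: "shol_at (\<lambda>y. expq (g y)) 0" if "shol_at g 0" for g
    by (rule shol_at_field[OF that expq_field_differentiable])
  \<comment> \<open>The displacement contains the factor \<open>coord w j\<close>, so only the value
    at w = 0 of the other factor counts, and there \<open>expq 0 = 1\<close>.\<close>
  have k: "((\<lambda>w. coord w j * (- pd ?l (?A w) * expq (- (coord w j * pd2 ?k ?l (?A w)))))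
      has_derivative (\<lambda>h. coord h j * - pd ?l z)) (at 0)"
    using has_derivative_coord_mult[OF shol_at_mult[OF shol_at_uminus[OF pd[of ?l]] expq[OF shol_at_uminus[OF pd2]]], of j]
    by (simp add: expq_def)
  have l: "((\<lambda>w. coord w j * (pd ?k (?A w) * expq (coord w j * pd2 ?k ?l (?A w))))
      has_derivative (\<lambda>h. coord h j * pd ?k z)) (at 0)"
    using has_derivative_coord_mult[OF shol_at_mult[OF pd[of ?k] expq[OF pd2]], of j]
    by (simp add: expq_def)
  have "has_cderiv (\<lambda>w. flow ?k ?l (coord w j) (?A w))
      (\<lambda>h. flows_deriv z j h + unit ?k (coord h j * - pd ?l z) + unit ?l (coord h j * pd ?k z)) 0"
    unfolding flow_def by (intro has_cderiv_add has_cderiv_unit Suc.IH k l) simp_all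
  moreover have "flows (Suc j) z = (\<lambda>w. flow ?k ?l (coord w j) (?A w))"
    by auto
  moreover have "flows_deriv z (Suc j) = (\<lambda>h. flows_deriv z j h + unit ?k (coord h j * - pd ?l z) + unit ?l (coord h j * pd ?k z))"
    by (auto simp: flows_deriv_def add.assoc)
  ultimately show ?case
    by simp
qed

text \<open>Tangent vectors are combinations of the fields indexed by \<open>(m, l)\<close> for any one \<open>m\<close> with
  \<open>pd m z \<noteq> 0\<close>.\<close>

lemma flows_deriv_surj:
  assumes z: "z \<in> X" and g: "g \<in> Cn (Suc d)" and tangent: "(\<Sum>k\<le>d. coord g k * pd k z) = 0"
  obtains h where "h \<in> Cn r" "flows_deriv z r h = g"
proof -
  obtain m where m: "m \<le> d" "pd m z \<noteq> 0"
    using smooth[of z] z by (auto simp: X_def pd_def)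
  \<comment> \<open>With these coefficients the field of (m, l) contributes \<open>coord g l\<close>
    in direction \<open>l\<close>. The by-products in direction \<open>m\<close> add up to the
    tangency sum divided by \<open>- pd m z\<close>, hence to 0.\<close>
  define c where "c l = coord g l / pd m z" for l
  define h where "h = tuple r (\<lambda>j. if j div Suc d = m then c (j mod Suc d) else 0)"
  let ?f = "\<lambda>i. unit (i div Suc d) (coord h i * - pd (i mod Suc d) z)
     + unit (i mod Suc d) (coord h i * pd (i div Suc d) z)"
  have "flows_deriv z r h = (\<Sum>i<r. ?f i)"
    by (simp add: flows_deriv_def)
  also have "\<dots> = (\<Sum>i\<in>(\<lambda>l. m * Suc d + l) ` {..d}. ?f i)"
  \<comment> \<open>Only the block of indices with quotient \<open>m\<close> carries nonzero
    coefficients.\<close>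
  proof (rule sum.mono_neutral_right)
    show "(\<lambda>l. m * Suc d + l) ` {..d} \<subseteq> {..<r}"
    proof
      fix i assume "i \<in> (\<lambda>l. m * Suc d + l) ` {..d}"
      then obtain l where "i = m * Suc d + l" "l \<le> d"
        by auto
      moreover have "m * Suc d \<le> d * Suc d"
        using m(1) by (rule mult_le_mono1)
      ultimately show "i \<in> {..<r}"
        by (simp add: r_def)
    qed
    show "\<forall>i\<in>{..<r} - (\<lambda>l. m * Suc d + l) ` {..d}. ?f i = 0"
    proof
      fix i assume i: "i \<in> {..<r} - (\<lambda>l. m * Suc d + l) ` {..d}"
      have "i div Suc d \<noteq> m"
      proof
        assume "i div Suc d = m"
        then have "i = m * Suc d + i mod Suc d"
          by (metis div_mult_mod_eq)
        moreover have "i mod Suc d \<in> {..d}"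
          using mod_less_divisor[of "Suc d" i] by simp
        ultimately show False
          using i by blast
      qed
      then have "coord h i = 0"
        by (simp add: h_def)
      then show "?f i = 0"
        by simp
    qed
  qed simp
  also have "\<dots> = (\<Sum>l\<le>d. ?f (m * Suc d + l))"
    by (subst sum.reindex) (auto simp: inj_on_def)
  also have "\<dots> = (\<Sum>l\<le>d. unit m (- (c l * pd l z)) + unit l (coord g l))"
  proof (rule sum.cong)
    fix l assume "l \<in> {..d}"
    then have l: "l \<le> d"
      by simp
    then have dm: "(m * Suc d + l) div Suc d = m" "(m * Suc d + l) mod Suc d = l"
      by (simp_all only: div_mult_self3 mod_mult_self3) (simp_all add: less_Suc_eq_le)
    have "m * Suc d \<le> d * Suc d"
      using m(1) by (rule mult_le_mono1)
    then have "m * Suc d + l < r"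
      using l by (simp add: r_def)
    then have "coord h (m * Suc d + l) = c l"
      by (simp only: h_def coord_tuple dm if_True simp_thms)
    then show "?f (m * Suc d + l) = unit m (- (c l * pd l z)) + unit l (coord g l)"
      using m(2) by (simp only: dm) (simp add: c_def)
  qed simp
  also have "\<dots> = g"
  proof (rule poly_mapping_eqI)
    fix k
    have "(\<Sum>l\<le>d. c l * pd l z) = (\<Sum>l\<le>d. coord g l * pd l z) / pd m z"
      by (simp add: c_def sum_divide_distrib)
    then have "(\<Sum>l\<le>d. c l * pd l z) = 0"
      using tangent by simp
    then show "coord (\<Sum>l\<le>d. unit m (- (c l * pd l z)) + unit l (coord g l)) k = coord g k"
      using g by (cases "m = k") (auto simp: lookup_sum lookup_add coord_unit sum.distrib sum_negf in_Cn_iff not_le)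
  qed
  finally show ?thesis
    by (rule that[rotated]) (simp add: h_def)
qed

section \<open>The equivariant spray on the trivial bundle\<close>

abbreviation "B \<equiv> trivial_bundle M r"

definition spray_map :: "cvec \<times> cvec \<Rightarrow> cvec" where
  "spray_map e = flows r (fst e) (snd e)"

lemma X_subset: "X \<subseteq> Cn (Suc d)"
  by (auto simp: X_def)

lemma spray_spray_map: "spray M B spray_map"
proof -
  have "holomorphic_map (prod_manifold M (Cn_manifold r)) M spray_map"
  proof (rule holomorphic_map_embedded[OF embedded_trivial_bundle[OF embedded_M] embedded_M,
        where F = "\<lambda>y. flows r (tuple (Suc d) (coord y)) (rest (Suc d) r y)"])
    show "vhol_at (\<lambda>y. flows r (tuple (Suc d) (coord y)) (rest (Suc d) r y)) x" for x
      by (rule vhol_at_flows[OF vhol_at_trunc vhol_at_rest])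
  qed (use X_subset in \<open>auto simp: spray_map_def flows_in_X tuple_cat rest_cat subset_iff\<close>)
  then show ?thesis
    unfolding spray_def using holomorphic_vector_bundle_trivial[OF embedded_M] by (simp add: spray_map_def)
qed

text \<open>Weights may be negative, and negative powers are holomorphic only away from 0; the group
  supplies \<open>f y \<noteq> 0\<close>.\<close>

lemma shol_at_powi_mult:
  assumes "shol_at f y" "shol_at g y" "f y \<noteq> 0"
  shows "shol_at (\<lambda>y. f y powi k * g y) y"
proof -
  have "(\<lambda>z. z powi k) field_differentiable at (f y)"
    using has_derivative_power_int'[OF assms(3), of k UNIV]
    unfolding field_differentiable_def has_field_derivative_def by (auto simp: mult_commute_abs)
  then show ?thesis
    by (intro shol_at_mult assms(2) shol_at_field[OF assms(1)])
qed

lemma vhol_at_act: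
  assumes "shol_at f y" "vhol_at A y" "f y \<noteq> 0"
  shows "vhol_at (\<lambda>y. act (f y) (A y)) y"
  unfolding act_def
  by (rule vhol_at_tuple, rule shol_at_powi_mult[OF assms(1) shol_at_coord_vhol[OF assms(2)] assms(3)])

lemma vhol_at_act_bundle:
  assumes "shol_at f y" "vhol_at A y" "f y \<noteq> 0"
  shows "vhol_at (\<lambda>y. act_bundle (f y) (A y)) y"
  unfolding act_bundle_def
  by (rule vhol_at_tuple, rule shol_at_powi_mult[OF assms(1) shol_at_coord_vhol[OF assms(2)] assms(3)])

lemma act_bundle_in_Cn [simp]: "act_bundle t w \<in> Cn r"
  by (simp add: act_bundle_def)

lemma act_one: "z \<in> Cn (Suc d) \<Longrightarrow> act 1 z = z"
  by (rule poly_mapping_eqI) (auto simp: act_def in_Cn_iff)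

lemma act_mult: "t \<noteq> 0 \<Longrightarrow> u \<noteq> 0 \<Longrightarrow> act (t * u) z = act t (act u z)"
  by (rule poly_mapping_eqI) (auto simp: act_def power_int_mult_distrib)

lemma act_bundle_one: "w \<in> Cn r \<Longrightarrow> act_bundle 1 w = w"
  by (rule poly_mapping_eqI) (auto simp: act_bundle_def in_Cn_iff)

lemma act_bundle_mult: "act_bundle (t * u) w = act_bundle t (act_bundle u w)"
  by (rule poly_mapping_eqI) (auto simp: act_bundle_def power_int_mult_distrib)

lemma holomorphic_action_act: "holomorphic_action Cstar Cstar_manifold M act"
proof -
  have "holomorphic_map (prod_manifold Cstar_manifold M) M (\<lambda>(g, x). act g x)"
  proof (rule holomorphic_map_embedded[OF embedded_prod_manifold[OF embedded_Cstar_manifold embedded_M] embedded_M,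
        where F = "\<lambda>y. act (coord y 0) (rest 1 (Suc d) y)"])
    fix e assume "e \<in> points (prod_manifold Cstar_manifold M)"
    then obtain t z where e: "e = (t, z)" "t \<noteq> 0" "z \<in> X" and z: "z \<in> Cn (Suc d)"
      using X_subset by auto
    show "(case e of (g, x) \<Rightarrow> act g x) \<in> points M"
      using e by (simp add: act_in_X)
    have c: "coord (cat 1 (unit 0 (fst e)) (snd e)) 0 = t"
      by (simp add: e coord_cat)
    then show "vhol_at (\<lambda>y. act (coord y 0) (rest 1 (Suc d) y)) (cat 1 (unit 0 (fst e)) (snd e))"
      using e(2) by (intro vhol_at_act shol_at_coord vhol_at_rest) simp
    show "(case e of (g, x) \<Rightarrow> act g x) =
        act (coord (cat 1 (unit 0 (fst e)) (snd e)) 0) (rest 1 (Suc d) (cat 1 (unit 0 (fst e)) (snd e)))"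
      using z by (simp only: c) (simp add: e rest_cat unit_in_Cn)
  qed
  then show ?thesis
    unfolding holomorphic_action_def
    using X_subset by (auto simp: Cstar_def act_one act_mult)
qed

lemma lifted_action_act:
  "lifted_action Cstar Cstar_manifold act B (\<lambda>g e. (act g (fst e), act_bundle g (snd e)))"
proof -
  let ?E = "prod_manifold M (Cn_manifold r)"
  note E = embedded_trivial_bundle[OF embedded_M, of r]
  let ?z = "\<lambda>y. rest 1 (Suc d + r) y"
  \<comment> \<open>The ambient coordinates are ordered (t, z, w): index 0 is t, and
    \<open>?z\<close> strips it off before z and w are separated.\<close>
  let ?F = "\<lambda>y. glue (Suc d) r (act (coord y 0) (tuple (Suc d) (coord (?z y)))) (act_bundle (coord y 0) (rest (Suc d) r (?z y)))"
  have "holomorphic_map (prod_manifold Cstar_manifold ?E) ?E (\<lambda>(g, e). (act g (fst e), act_bundle g (snd e)))"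
  proof (rule holomorphic_map_embedded[OF embedded_prod_manifold[OF embedded_Cstar_manifold E] E, where F = ?F])
    fix e assume "e \<in> points (prod_manifold Cstar_manifold ?E)"
    then obtain t z w where e: "e = (t, z, w)" "t \<noteq> 0" "z \<in> X" "w \<in> Cn r" and z: "z \<in> Cn (Suc d)"
      using X_subset by auto
    show "(case e of (g, e) \<Rightarrow> (act g (fst e), act_bundle g (snd e))) \<in> points ?E"
      using e by (simp add: act_in_X)
    let ?y = "cat 1 (unit 0 (fst e)) (cat (Suc d) (fst (snd e)) (snd (snd e)))"
    have c: "coord ?y 0 = t"
      by (simp add: e coord_cat)
    have zy: "?z ?y = cat (Suc d) z w"
      unfolding e(1) fst_conv snd_conv by (rule rest_cat[OF unit_in_Cn cat_in_Cn[OF z e(4)]]) simp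
    show "vhol_at ?F ?y"
      by (intro vhol_at_glue vhol_at_act vhol_at_act_bundle shol_at_coord
          vhol_at_compose[OF vhol_at_trunc vhol_at_rest] vhol_at_compose[OF vhol_at_rest vhol_at_rest])
        (simp_all only: c e(2) not_False_eq_True)
    show "cat (Suc d) (fst (case e of (g, e) \<Rightarrow> (act g (fst e), act_bundle g (snd e))))
        (snd (case e of (g, e) \<Rightarrow> (act g (fst e), act_bundle g (snd e)))) = ?F ?y"
      unfolding c zy tuple_cat[OF z] rest_cat[OF z e(4)] by (simp add: e(1) cat_eq_glue[of _ _ _ r])
  qed
  then have "holomorphic_action Cstar Cstar_manifold ?E (\<lambda>g e. (act g (fst e), act_bundle g (snd e)))"
    unfolding holomorphic_action_def
    using X_subset by (auto simp: Cstar_def act_one act_mult act_bundle_one act_bundle_mult)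
  moreover have "act_bundle t (v + w) = act_bundle t v + act_bundle t w" for t v w
    by (rule poly_mapping_eqI) (simp add: act_bundle_def lookup_add algebra_simps)
  moreover have "act_bundle t (cscale c w) = cscale c (act_bundle t w)" for t c w
    by (rule poly_mapping_eqI) (simp add: act_bundle_def)
  ultimately show ?thesis
    unfolding lifted_action_def by simp
qed

lemma T_spray_spray_map: "T_spray Cstar Cstar_manifold M act B spray_map"
  unfolding T_spray_def
proof (intro conjI exI)
  show "spray M B spray_map"
    by (rule spray_spray_map)
  show "lifted_action Cstar Cstar_manifold act B (\<lambda>g e. (act g (fst e), act_bundle g (snd e)))"
    by (rule lifted_action_act)
  show "\<forall>g\<in>carrier Cstar. \<forall>e\<in>points (total B). spray_map (act g (fst e), act_bundle g (snd e)) = act g (spray_map e)"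
    using X_subset by (auto simp: spray_map_def Cstar_def flows_act subset_iff)
qed

section \<open>Domination in arbitrary charts\<close>

text \<open>A fibre chart is an arbitrary linear bijection without any continuity assumption. Its
  inverse is determined by the preimages of the \<open>r\<close> unit vectors, and the matrix
  \<open>L\<close> built from them is differentiable on the whole space.\<close>

lemma fibre_chart_inverse:
  assumes \<phi>: "(U, \<phi>) \<in> mcharts (fibre_manifold B x)" and x: "x \<in> X"
  obtains L where "has_cderiv L L 0" "L ` Cn r = Cn r"
    "\<And>w. w \<in> Cn r \<Longrightarrow> inv_into U \<phi> w = (x, L w)" "\<phi> ` U = Cn r" "\<phi> (x, 0) = 0"
    "U = {x} \<times> Cn r"
proof -
  have "fibre B x = {x} \<times> Cn r"
    using x by (auto simp: over_def)
  with \<phi> have U: "U = {x} \<times> Cn r" and bij: "bij_betw \<phi> U (Cn r)"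
    and add: "\<And>v w. v \<in> Cn r \<Longrightarrow> w \<in> Cn r \<Longrightarrow> \<phi> (x, v + w) = \<phi> (x, v) + \<phi> (x, w)"
    and scale: "\<And>c w. w \<in> Cn r \<Longrightarrow> \<phi> (x, cscale c w) = cscale c (\<phi> (x, w))"
    by (auto simp: fibre_manifold_def)
  define e where "e i = snd (inv_into U \<phi> (unit i 1))" for i
  define L where "L w = tuple r (\<lambda>j. \<Sum>i<r. coord w i * coord (e i) j)" for w
  have e: "e i \<in> Cn r" "\<phi> (x, e i) = unit i 1" if "i < r" for i
  proof -
    have 1: "unit i 1 \<in> \<phi> ` U"
      using bij that by (simp add: bij_betw_def unit_in_Cn)
    have 2: "inv_into U \<phi> (unit i 1) \<in> {x} \<times> Cn r"
      using inv_into_into[OF 1] U by simp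
    then have 3: "inv_into U \<phi> (unit i 1) = (x, e i)"
      by (auto simp: e_def)
    show "e i \<in> Cn r"
      using 2 by (auto simp: e_def)
    show "\<phi> (x, e i) = unit i 1"
      using f_inv_into_f[OF 1] by (simp add: 3)
  qed
  have zero: "\<phi> (x, 0) = 0"
    using add[of 0 0] by simp
  \<comment> \<open>\<open>\<phi>\<close> is additive only for vectors of the fibre, so membership
    of the partial sums in \<open>Cn r\<close> is carried through the induction.\<close>
  have sum: "(\<Sum>i<n. cscale (coord w i) (e i)) \<in> Cn r \<and>
      \<phi> (x, \<Sum>i<n. cscale (coord w i) (e i)) = (\<Sum>i<n. unit i (coord w i))" if "n \<le> r" for n w
    using that
  proof (induction n)
    case (Suc n)
    have "cscale (coord w n) (unit n 1) = unit n (coord w n)"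
      by (rule poly_mapping_eqI) (simp add: coord_unit)
    with Suc show ?case
      by (simp add: add scale e add_in_Cn cscale_in_Cn)
  qed (simp add: zero)
  have L: "L w = (\<Sum>i<r. cscale (coord w i) (e i))" for w
    using sum[of r w] by (intro poly_mapping_eqI) (auto simp: L_def lookup_sum in_Cn_iff)
  have inv: "inv_into U \<phi> w = (x, L w)" if "w \<in> Cn r" for w
  proof (rule inv_into_f_eq)
    show "inj_on \<phi> U"
      using bij by (simp add: bij_betw_def)
    show "(x, L w) \<in> U"
      unfolding U L_def by simp
    show "\<phi> (x, L w) = w"
      using sum[of r w] tuple_coord[OF that] by (simp add: L tuple_def)
  qed
  have "L ` Cn r = Cn r"
  proof (intro equalityI subsetI)
    fix v assume v: "v \<in> Cn r"
    then have vU: "(x, v) \<in> U"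
      by (simp add: U)
    then have "\<phi> (x, v) \<in> Cn r"
      using bij unfolding bij_betw_def by blast
    moreover from inv[OF this] have "v = L (\<phi> (x, v))"
      using inv_into_f_f[OF bij_betw_imp_inj_on[OF bij] vU] by simp
    ultimately show "v \<in> L ` Cn r"
      by blast
  qed (auto simp: L_def)
  moreover have "has_cderiv L L 0"
    unfolding L_def by (rule has_cderiv_linear)
  moreover have "\<phi> ` U = Cn r"
    using bij by (simp add: bij_betw_def)
  ultimately show ?thesis
    using inv zero U by (intro that)
qed

text \<open>Differentiability of the spray is not enough; its derivative must be known. Let the
  inverse of the chart \<open>\<psi>\<close> send a direction \<eta> to a vector g. As
  \<open>q\<close> vanishes along that inverse, g is tangent, hence a value of
  \<open>flows_deriv\<close>; and the chart sends g back to \<eta>.\<close>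

lemma submersion_spray_map:
  assumes x: "x \<in> X"
  shows "submersion_at (fibre_manifold B x) M spray_map (bzero B x)"
proof -
  have "\<exists>D. has_complex_derivative (mdim (fibre_manifold B x)) (\<phi> ` {y \<in> U. spray_map y \<in> V})
          (\<psi> \<circ> spray_map \<circ> inv_into U \<phi>) (\<phi> (x, 0)) D \<and>
        D ` Cn (mdim (fibre_manifold B x)) = Cn (mdim M)"
    if \<phi>: "(U, \<phi>) \<in> mcharts (fibre_manifold B x)" and \<psi>: "(V, \<psi>) \<in> mcharts M"
      and xV: "spray_map (x, 0) \<in> V" for U \<phi> V \<psi>
  proof -
    have xV: "x \<in> V"
      using xV by (simp add: spray_map_def)
    have rank: "mdim (fibre_manifold B x) = r"
      by (simp add: fibre_manifold_def)
    obtain L where L: "has_cderiv L L 0" "L ` Cn r = Cn r"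
      and inv: "\<And>w. w \<in> Cn r \<Longrightarrow> inv_into U \<phi> w = (x, L w)"
      and \<phi>U: "\<phi> ` U = Cn r" "\<phi> (x, 0) = 0" "U = {x} \<times> Cn r"
      using fibre_chart_inverse[OF \<phi> x] by blast
    have L0: "L 0 = 0"
    proof -
      have "L (cscale 0 0) = cscale 0 (L 0)"
        using L(1) by (simp add: has_cderiv_def)
      moreover have "cscale 0 v = 0" for v
        by (rule poly_mapping_eqI) simp
      ultimately show ?thesis
        by simp
    qed
    have ch: "chart_via M (\<lambda>x. x) V \<psi>"
      by (rule induced_chart_via[OF X_subset \<psi>])
    obtain W F where W: "open W" "x \<in> W" and F: "\<And>y. y \<in> W \<Longrightarrow> vhol_at F y"
      "\<And>x'. x' \<in> V \<Longrightarrow> x' \<in> W \<Longrightarrow> \<psi> x' = F x'"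
      using chart_via_local[OF ch xV] by blast
    obtain G where G: "\<And>x. x \<in> V \<Longrightarrow> vhol_at G (\<psi> x)" "\<And>x. x \<in> V \<Longrightarrow> G (\<psi> x) = x"
      using chart_via_inverse[OF ch] by blast
    obtain DF where DF: "has_cderiv F DF x"
      using F(1)[OF W(2)] vhol_at_def by blast
    obtain DG where DG: "has_cderiv G DG (\<psi> x)"
      using G(1)[OF xV] vhol_at_def by blast
    obtain Dq where Dq: "(q has_derivative Dq) (at x)" "\<And>c h. Dq (cscale c h) = c * Dq h"
      using hol shol_at_def by blast
    have opV: "openin (top_of_set (Cn d)) (\<psi> ` V)"
      using ch by (simp add: chart_via_def)
    have VX: "V \<subseteq> X"
      using chart_domain[OF ch] by auto
    let ?t = "\<lambda>n y. tuple n (coord y)"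
    \<comment> \<open>Away from X, or from the image of the chart, \<open>F\<close> and
      \<open>G\<close> may take values outside \<open>Cn d\<close> and \<open>Cn (Suc d)\<close>.
      Truncation keeps their derivatives inside without changing them where they represent the chart
      and its inverse.\<close>
    define H where "H y = ?t d (F y)" for y
    define K where "K y = ?t (Suc d) (G y)" for y
    have DH: "has_cderiv H (\<lambda>h. ?t d (DF h)) x"
      unfolding H_def by (rule has_cderiv_compose[OF DF has_cderiv_trunc])
    have DK: "has_cderiv K (\<lambda>h. ?t (Suc d) (DG h)) (\<psi> x)"
      unfolding K_def by (rule has_cderiv_compose[OF DG has_cderiv_trunc])
    have K: "K (\<psi> y) = y" if "y \<in> V" for y
      using G(2)[OF that] VX X_subset that by (auto simp: K_def tuple_coord)
    have H: "H y = \<psi> y" if "y \<in> V" "y \<in> W" for y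
      using F(2)[OF that] chart_range[OF ch that(1)] by (simp add: H_def tuple_coord)
    define D where "D h = ?t d (DF (flows_deriv x r (L h)))" for h
    have S: "has_cderiv (\<lambda>w. flows r x (L w)) (\<lambda>h. flows_deriv x r (L h)) 0"
      using has_cderiv_compose[OF L(1), of "flows r x" "flows_deriv x r"] has_cderiv_flows L0 by simp
    have HS: "has_cderiv (\<lambda>w. H (flows r x (L w))) D 0"
      unfolding D_def using has_cderiv_compose[OF S, of H "\<lambda>h. ?t d (DF h)"] DH L0 by simp
    have "has_complex_derivative r (\<phi> ` {y \<in> U. spray_map y \<in> V})
          (\<psi> \<circ> spray_map \<circ> inv_into U \<phi>) 0 D"
    proof (rule has_complex_derivative_of_cderiv[OF HS])
      show "0 \<in> \<phi> ` {y \<in> U. spray_map y \<in> V}"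
        using \<phi>U xV by (intro image_eqI[of _ _ "(x, 0)"]) (auto simp: spray_map_def)
      have val: "(\<psi> \<circ> spray_map \<circ> inv_into U \<phi>) w = H (flows r x (L w))"
        if w: "w \<in> \<phi> ` {y \<in> U. spray_map y \<in> V}" "flows r x (L w) \<in> W" for w
      proof -
        from w(1) obtain y where y: "y \<in> U" "spray_map y \<in> V" "w = \<phi> y"
          by blast
        have wr: "w \<in> Cn r"
          using y(1,3) \<phi>U(1) by blast
        have "inj_on \<phi> U"
          using \<phi> by (auto simp: fibre_manifold_def bij_betw_def)
        then have "y = (x, L w)"
          using inv[OF wr] y by (simp add: inv_into_f_f)
        then have "flows r x (L w) \<in> V"
          using y(2) by (simp add: spray_map_def)
        then show ?thesis
          using w(2) by (simp add: inv[OF wr] spray_map_def H)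
      qed
      have "isCont (\<lambda>w. flows r x (L w)) 0"
        using S by (intro vhol_at_isCont) (auto simp: vhol_at_def)
      then have "\<forall>\<^sub>F w in nhds 0. flows r x (L w) \<in> W"
        using W L0 by (auto simp: continuous_at_open eventually_nhds)
      then show "\<forall>\<^sub>F w in at 0 within \<phi> ` {y \<in> U. spray_map y \<in> V}.
          (\<psi> \<circ> spray_map \<circ> inv_into U \<phi>) w = H (flows r x (L w))"
        unfolding eventually_at_filter by (rule eventually_mono) (intro impI, rule val)
      show "(\<psi> \<circ> spray_map \<circ> inv_into U \<phi>) 0 = H (flows r x (L 0))"
        using \<open>0 \<in> _\<close> W(2) by (intro val) (simp_all add: L0)
    qed
    moreover have "D ` Cn r = Cn d"
    proof (intro equalityI subsetI)
      fix \<eta> assume \<eta>: "\<eta> \<in> Cn d"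
      define g where "g = ?t (Suc d) (DG \<eta>)"
      have Kx: "K (\<psi> x) = x"
        by (rule K[OF xV])
      have "((\<lambda>y. q (K y)) has_derivative (\<lambda>h. Dq (?t (Suc d) (DG h)))) (at (\<psi> x))"
        using has_derivative_compose[of K _ "\<psi> x" UNIV q Dq] DK Dq(1) Kx
        by (simp add: has_cderiv_def)
      \<comment> \<open>\<open>q\<close> composed with \<open>K\<close> is zero on the image of the
        chart, which is open in \<open>Cn d\<close>, so its derivative vanishes in directions of
        \<open>Cn d\<close>.\<close>
      then have "Dq (?t (Suc d) (DG \<eta>)) = 0"
      proof (rule derivative_unique_Cn[OF _ has_derivative_const opV _ _ \<eta>])
        show "\<psi> x \<in> \<psi> ` V"
          using xV by blast
        show "q (K y) = 0" if "y \<in> \<psi> ` V" for y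
          using that K VX by (auto simp: X_def)
      qed
      then have "(\<Sum>k\<le>d. coord g k * pd k x) = 0"
        using q_derivative[OF Dq, of g] by (simp add: g_def)
      then obtain h where h: "h \<in> Cn r" "flows_deriv x r h = g"
        using flows_deriv_surj[OF x, of g] by (auto simp: g_def)
      then obtain w where w: "w \<in> Cn r" "h = L w"
        using L(2) by blast
      have "continuous_on (\<psi> ` V) K"
      proof (rule continuous_on_vhol)
        fix y assume "y \<in> \<psi> ` V"
        then have "vhol_at G y"
          using G(1) by blast
        then show "vhol_at K y"
          unfolding K_def[abs_def] by (rule vhol_at_compose[OF vhol_at_trunc])
      qed
      then have "openin (top_of_set (\<psi> ` V)) (\<psi> ` V \<inter> K -` W)"
        using W(1) by (rule continuous_openin_preimage_gen)
      then have op': "openin (top_of_set (Cn d)) (\<psi> ` V \<inter> K -` W)"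
        using opV openin_trans by blast
      have "((\<lambda>y. H (K y)) has_derivative (\<lambda>h. ?t d (DF (?t (Suc d) (DG h))))) (at (\<psi> x))"
        using has_cderiv_compose[OF DK, of H "\<lambda>h. ?t d (DF h)"] DH Kx
        by (simp add: has_cderiv_def)
      \<comment> \<open>\<open>H\<close> after \<open>K\<close> is the identity on the part of the
        chart image that \<open>K\<close> sends into \<open>W\<close>, so the derivative of the
        composition fixes \<eta>.\<close>
      then have "?t d (DF (?t (Suc d) (DG \<eta>))) = \<eta>"
      proof (rule derivative_unique_Cn[OF _ has_derivative_ident op' _ _ \<eta>])
        show "\<psi> x \<in> \<psi> ` V \<inter> K -` W"
          using xV W(2) Kx by simp
        show "H (K y) = y" if "y \<in> \<psi> ` V \<inter> K -` W" for y
          using that K H by auto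
      qed
      then have "D w = \<eta>"
        using h w by (simp add: D_def g_def)
      then show "\<eta> \<in> D ` Cn r"
        using w(1) by blast
    qed (auto simp: D_def)
    ultimately show ?thesis
      unfolding rank \<phi>U(2) by auto
  qed
  then show ?thesis
    unfolding submersion_at_def by auto
qed

lemma T_elliptic_M: "T_elliptic Cstar Cstar_manifold M act"
  unfolding T_elliptic_def dominating_def
  using complex_lie_group_Cstar complex_manifold_embedded[OF embedded_M] holomorphic_action_act
    T_spray_spray_map submersion_spray_map
  by (intro conjI exI[of _ B] exI[of _ spray_map] ballI) simp_all

end

subsection \<open>Polynomials of degree at most one in each variable\<close>

definition mon :: "(nat \<Rightarrow>\<^sub>0 nat) \<Rightarrow> (nat \<Rightarrow> complex) \<Rightarrow> complex" where
  "mon m x = (\<Prod>i\<in>Poly_Mapping.keys m. x i ^ Poly_Mapping.lookup m i)"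

text \<open>Evaluating over a common index set allows polynomials with different supports to be
  added termwise.\<close>

lemma peval_superset:
  assumes "finite A" "Poly_Mapping.keys p \<subseteq> A"
  shows "peval p x = (\<Sum>m\<in>A. Poly_Mapping.lookup p m * mon m x)"
  unfolding peval_def mon_def
  by (rule sum.mono_neutral_left) (use assms in \<open>auto simp: in_keys_iff\<close>)

lemma peval_add: "peval (p + p') x = peval p x + peval p' x"
proof -
  let ?A = "Poly_Mapping.keys p \<union> Poly_Mapping.keys p'"
  have "Poly_Mapping.keys (p + p') \<subseteq> ?A"
    by (rule Poly_Mapping.keys_add)
  then show ?thesis
    by (simp add: peval_superset[of ?A] lookup_add distrib_right sum.distrib)
qed

lemma peval_zero: "peval 0 x = 0"
  by (simp add: peval_def)

lemma peval_sum: "peval (\<Sum>i\<in>I. f i) x = (\<Sum>i\<in>I. peval (f i) x)"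
  by (induction I rule: infinite_finite_induct) (simp_all add: peval_zero peval_add)

lemma peval_single: "peval (Poly_Mapping.single m c) x = c * mon m x"
  by (subst peval_superset[of "{m}"]) simp_all

text \<open>The exponent is 0 or 1. If it is 1, the monomial is x_i times a monomial free of x_i; if
  it is 0, the truncated subtraction leaves \<open>m\<close> as it is, but the coefficient is
  0.\<close>

lemma mon_add_coord:
  assumes "Poly_Mapping.lookup m i \<le> 1"
  shows "mon m (x(i := x i + s)) =
    mon m x + s * (of_nat (Poly_Mapping.lookup m i) * mon (m - Poly_Mapping.single i 1) x)"
proof (cases "Poly_Mapping.lookup m i = 0")
  case True
  then have "i \<notin> Poly_Mapping.keys m"
    by (simp add: in_keys_iff)
  then have "mon m (x(i := x i + s)) = mon m x"
    unfolding mon_def by (intro prod.cong) auto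
  with True show ?thesis
    by simp
next
  case False
  with assms have i: "Poly_Mapping.lookup m i = 1"
    by simp
  let ?m = "m - Poly_Mapping.single i 1"
  have l: "Poly_Mapping.lookup ?m j = (if j = i then 0 else Poly_Mapping.lookup m j)" for j
    by (simp add: lookup_minus lookup_single when_def i)
  have keys: "Poly_Mapping.keys m = insert i (Poly_Mapping.keys ?m)" "i \<notin> Poly_Mapping.keys ?m"
    by (auto simp: in_keys_iff l i simp del: One_nat_def split: if_splits)
  have mon: "mon m y = y i * mon ?m y" for y
  proof -
    have "(\<Prod>j\<in>Poly_Mapping.keys ?m. y j ^ Poly_Mapping.lookup m j) = mon ?m y"
      unfolding mon_def using keys(2) by (intro prod.cong) (auto simp: l simp del: One_nat_def)
    then show ?thesis
      unfolding mon_def[of m] keys(1) using keys(2) by (simp add: i)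
  qed
  have "mon ?m (x(i := x i + s)) = mon ?m x"
    unfolding mon_def using keys(2) by (intro prod.cong) auto
  then show ?thesis
    by (simp add: mon i algebra_simps)
qed

text \<open>The Taylor expansion in a variable of degree at most one stops after the linear term, so
  the formal derivative is the exact slope.\<close>

lemma peval_add_coord:
  assumes "degree_in i p \<le> 1"
  shows "peval p (x(i := x i + s)) = peval p x + s * peval (partial i p) x"
proof -
  have "Poly_Mapping.lookup m i \<le> 1" if "m \<in> Poly_Mapping.keys p" for m
  proof -
    have "Poly_Mapping.lookup m i \<le> degree_in i p"
      unfolding degree_in_def using that by (intro Max_ge) auto
    then show ?thesis
      using assms by simp
  qed
  then have "peval p (x(i := x i + s)) = (\<Sum>m\<in>Poly_Mapping.keys p. Poly_Mapping.lookup p m *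
      (mon m x + s * (of_nat (Poly_Mapping.lookup m i) * mon (m - Poly_Mapping.single i 1) x)))"
    by (simp add: peval_superset[of "Poly_Mapping.keys p"] mon_add_coord)
  also have "\<dots> = peval p x + s * peval (partial i p) x"
    by (simp add: partial_def peval_sum peval_single peval_superset[of "Poly_Mapping.keys p" p]
        sum_distrib_left sum.distrib[symmetric] algebra_simps)
  finally show ?thesis .
qed

lemma shol_at_peval: "shol_at (\<lambda>z. peval p (\<lambda>i. coord z (i + 2))) z"
  unfolding peval_def
  by (intro shol_at_sum shol_at_mult shol_at_const shol_at_prod shol_at_power shol_at_coord)

section \<open>The function uv - p(x) and its torus weights\<close>

definition uv_function :: "cpolynomial \<Rightarrow> cvec \<Rightarrow> complex" where
  "uv_function p z = coord z 0 * coord z 1 - peval p (\<lambda>i. coord z (i + 2))"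

definition uv_weight :: "nat \<Rightarrow> int" where
  "uv_weight i = (if i = 0 then 1 else if i = 1 then - 1 else 0)"

lemma uv_function_add_x:
  assumes "degree_in i p \<le> 1"
  shows "uv_function p (z + unit (i + 2) s) =
    uv_function p z - s * peval (partial i p) (\<lambda>i. coord z (i + 2))"
proof -
  have "(\<lambda>j. coord (z + unit (i + 2) s) (j + 2)) = (\<lambda>j. coord z (j + 2))(i := coord z (i + 2) + s)"
    by (auto simp: lookup_add coord_unit)
  then show ?thesis
    using peval_add_coord[OF assms, of "\<lambda>j. coord z (j + 2)" s]
    by (simp add: uv_function_def lookup_add coord_unit)
qed

lemma uv_function_add_u: "uv_function p (z + unit 0 s) = uv_function p z + s * coord z 1"
  and uv_function_add_v: "uv_function p (z + unit 1 s) = uv_function p z + s * coord z 0"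
  by (simp_all add: uv_function_def lookup_add coord_unit algebra_simps)

lemma affine_hypersurface_uv:
  assumes deg: "\<forall>i<n. degree_in i p \<le> 1" and smooth: "smooth_reduced_zero_set n p"
  shows "affine_hypersurface (n + 1) (uv_function p) uv_weight"
proof
  show "shol_at (uv_function p) z" for z
    unfolding uv_function_def[abs_def]
    by (intro shol_at_diff shol_at_mult shol_at_coord shol_at_peval)
  have cases: "k = 0 \<or> k = 1 \<or> (\<exists>i<n. k = i + 2)" if "k \<le> n + 1" for k
    using that by presburger
  show "uv_function p (z + unit k s) = uv_function p z + s * (uv_function p (z + unit k 1) - uv_function p z)"
    if "k \<le> n + 1" for k z s
    using cases[OF that] deg
    by (auto simp: uv_function_add_u uv_function_add_v uv_function_add_x
        simp del: add_2_eq_Suc' One_nat_def single_one)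
next
  fix z assume z: "z \<in> Cn (Suc (n + 1))" and q: "uv_function p z = 0"
  show "\<exists>k\<le>n + 1. uv_function p (z + unit k 1) \<noteq> uv_function p z"
  \<comment> \<open>The partial derivatives by u and v are v and u. Where both vanish, q = 0 forces
    p(x) = 0, and smoothness of the zero set of p provides a nonzero derivative in some x_i.\<close>
  proof (cases "coord z 0 = 0 \<and> coord z 1 = 0")
    case True
    define x where "x = tuple n (\<lambda>i. coord z (i + 2))"
    have x: "coord x = (\<lambda>i. coord z (i + 2))"
      using z by (auto simp: x_def in_Cn_iff)
    have "peval p (coord x) = 0"
      using q True by (simp add: uv_function_def x)
    moreover have "x \<in> Cn n"
      by (simp add: x_def)
    ultimately obtain i where i: "i < n" "peval (partial i p) (coord x) \<noteq> 0"
      using smooth unfolding smooth_reduced_zero_set_def by blast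
    then have "uv_function p (z + unit (i + 2) 1) \<noteq> uv_function p z"
      using deg by (simp add: uv_function_add_x x del: add_2_eq_Suc')
    then show ?thesis
      using i(1) by (intro exI[of _ "i + 2"]) simp
  next
    case False
    then show ?thesis
    proof (cases "coord z 1 = 0")
      case True
      with False show ?thesis
        by (intro exI[of _ 1]) (simp add: uv_function_add_v del: One_nat_def)
    next
      case False
      then show ?thesis
        by (intro exI[of _ 0]) (simp add: uv_function_add_u del: single_one)
    qed
  qed
next
  fix t :: complex and z
  assume t: "t \<noteq> 0" and z: "z \<in> Cn (Suc (n + 1))"
  have "(\<lambda>i. coord (tuple (Suc (n + 1)) (\<lambda>i. t powi uv_weight i * coord z i)) (i + 2))
      = (\<lambda>i. coord z (i + 2))"
    using z by (auto simp: in_Cn_iff uv_weight_def)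
  then show "uv_function p (tuple (Suc (n + 1)) (\<lambda>i. t powi uv_weight i * coord z i)) = uv_function p z"
    using t by (simp add: uv_function_def uv_weight_def power_int_minus)
qed

theorem proposition3p10:
  fixes n :: nat and p :: cpolynomial
  assumes "2 \<le> n"
    and "p \<in> polynomials n"
    and "\<forall>i<n. degree_in i p \<le> 1"
    and "smooth_reduced_zero_set n p"
  shows "T_elliptic Cstar Cstar_manifold
           (induced_manifold (n + 2) (n + 1) (uv_hypersurface n p)) (uv_action n)"
proof -
  interpret affine_hypersurface "n + 1" "uv_function p" uv_weight
    using assms(3,4) by (rule affine_hypersurface_uv)
  \<comment> \<open>The locale counts coordinates 0, ..., d with d = n + 1: the ambient dimension is
    n + 2 and the hypersurface has dimension n + 1.\<close>
  have dim: "Suc (n + 1) = n + 2"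
    by simp
  have "X = uv_hypersurface n p"
    unfolding X_def uv_hypersurface_def uv_function_def dim ..
  moreover have "act = uv_action n"
  proof (intro ext poly_mapping_eqI)
    fix t z j
    have "coord (\<Sum>i<n. unit (i + 2) (coord z (i + 2))) j = (if 2 \<le> j \<and> j < n + 2 then coord z j else 0)"
    proof -
      have "coord (\<Sum>i<n. unit (i + 2) (coord z (i + 2))) j
          = (\<Sum>i<n. if i = j - 2 then (if 2 \<le> j then coord z j else 0) else 0)"
        unfolding lookup_sum by (intro sum.cong) (auto simp: coord_unit)
      also have "\<dots> = (if 2 \<le> j \<and> j < n + 2 then coord z j else 0)"
        by auto
      finally show ?thesis .
    qed
    moreover have "j = 0 \<or> j = 1 \<or> 2 \<le> j"
      by linarith
    ultimately show "coord (act t z) j = coord (uv_action n t z) j"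
      unfolding act_def uv_action_def dim lookup_add
      by (auto simp: uv_weight_def coord_unit power_int_minus)
  qed
  ultimately show ?thesis
    using T_elliptic_M by (simp only: dim)
qed

end
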